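(* Let $n\ge 3$ and let $X=(x_0,\dots,x_{n-1})$ and $X'=(x'_0,\dots,x'_{n-1})$ be two $n$-tuples of points of $\mathbb{R}^3$, each in general position. If the affine strong geometries $\mathsf{SGeom}_{\mathsf{Aff}}(X)$ and $\mathsf{SGeom}_{\mathsf{Aff}}(X')$ are isomorphic, then the polygonal knots $K_X$ and $K_{X'}$ are (ambiently) isotopic.
   Context: General position: no four of the points are coplanar. $K_X$ is the closed polygonal curve $[x_0,x_1]\cup[x_1,x_2]\cup\dots\cup[x_{n-2},x_{n-1}]\cup[x_{n-1},x_0]$ (indices mod $n$). Notation: $\Delta=\mathsf{sign}\circ\det$. For $m$ vectors' worth of space $\mathbb{R}^m$ and an $(m-1)$-tuple $V=(v_1,\dots,v_{m-1})$ of vectors of $\mathbb{R}^m$, $\boldsymbol{\alpha}(V)$ is the unit vector orthogonal to all $v_i$ with $\det(v_1,\dots,v_{m-1},\boldsymbol{\alpha}(V))>0$ if the $v_i$ are linearly independent, and $\boldsymbol{\alpha}(V)=0$ otherwise. Let $\mathsf{in}(x)=(1,x)\in\mathbb{R}^4$ for $x\in\mathbb{R}^3$. The affine chirotope of $X$ is $\chi(i_1,i_2,i_3,i_4)=\Delta(\mathsf{in}(x_{i_1}),\dots,\mathsf{in}(x_{i_4}))$ for $i_j\in\{0,\dots,n-1\}$. The wedge chirotope of $\mathsf{in}(X)$ is the function on $4$-tuples $(I_1,\dots,I_4)$ of elements of $\{0,\dots,n-1\}^3$ given by $\chi_\Lambda(I_1,\dots,I_4)=\Delta(\boldsymbol{\alpha}(\mathsf{in}(X)_{I_1}),\dots,\boldsymbol{\alpha}(\mathsf{in}(X)_{I_4}))$,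 where for $I=(i_1,i_2,i_3)$, $\mathsf{in}(X)_I=(\mathsf{in}(x_{i_1}),\mathsf{in}(x_{i_2}),\mathsf{in}(x_{i_3}))$. The strong geometry $\mathsf{SGeom}_{\mathsf{Aff}}(X)$ is the pair (affine chirotope of $X$, wedge chirotope of $\mathsf{in}(X)$); two such strong geometries are isomorphic when both chirotopes coincide under the identification $x_i\leftrightarrow x'_i$ of indices.
   Formalization: For n = 3, where "no four points coplanar" is vacuous and the claim fails (a collinear triple and a triangle have the same, zero, chirotopes), general position is also taken to require that the three points are not collinear; nothing is added for n ≥ 4. *)

theory Defs
  imports "HOL-Analysis.Analysis"
begin

(* An n-tuple (x_0, ..., x_{n-1}) is a function on nat of which only the values at
   indices below n matter. *)

(* For n = 3 "no four points coplanar" holds vacuously, even if the three points are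
   collinear or coincide, in which case the polygon is not a knot.  The second conjunct
   excludes exactly these degenerate triples and says nothing for n > 3. *)
definition general_position :: "nat \<Rightarrow> (nat \<Rightarrow> real^3) \<Rightarrow> bool" where
  "general_position n x \<longleftrightarrow>
     (\<forall>i<n. \<forall>j<n. \<forall>k<n. \<forall>l<n. distinct [i, j, k, l] \<longrightarrow> \<not> coplanar {x i, x j, x k, x l}) \<and>
     (n = 3 \<longrightarrow> \<not> collinear {x 0, x 1, x 2})"

definition polygonal_knot :: "nat \<Rightarrow> (nat \<Rightarrow> real^3) \<Rightarrow> (real^3) set" where
  "polygonal_knot n x = (\<Union>i<n. closed_segment (x i) (x ((i + 1) mod n)))"

(* The library proves these selector rules only up to dimension 3.  In the index type 4
   the numeral 4 denotes 0, but the order of the list is still the order 1, 2, 3, 4. *)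
lemma vector_4 [simp]:
  "(vector [x, y, z, w] :: 'a::zero^4) $ 1 = x"
  "(vector [x, y, z, w] :: 'a::zero^4) $ 2 = y"
  "(vector [x, y, z, w] :: 'a::zero^4) $ 3 = z"
  "(vector [x, y, z, w] :: 'a::zero^4) $ 4 = w"
  unfolding vector_def by simp_all

definition det4 :: "real^4 \<Rightarrow> real^4 \<Rightarrow> real^4 \<Rightarrow> real^4 \<Rightarrow> real" where
  "det4 a b c d = det (vector [a, b, c, d] :: real^4^4)"

definition sign_det :: "real^4 \<Rightarrow> real^4 \<Rightarrow> real^4 \<Rightarrow> real^4 \<Rightarrow> real" where
  "sign_det a b c d = sgn (det4 a b c d)"

(* The unit normal of a triple of vectors, written in the dimension 4 in which it is used.
   The condition distinct makes independence a property of the triple, not of the set. *)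
definition unit_normal :: "real^4 \<Rightarrow> real^4 \<Rightarrow> real^4 \<Rightarrow> real^4" where
  "unit_normal a b c =
     (if distinct [a, b, c] \<and> independent {a, b, c}
      then (THE u. norm u = 1 \<and> orthogonal u a \<and> orthogonal u b \<and> orthogonal u c \<and>
                   det4 a b c u > 0)
      else 0)"

definition homogenize :: "real^3 \<Rightarrow> real^4" where
  "homogenize p = vector [1, p $ 1, p $ 2, p $ 3]"

type_synonym idx3 = "nat \<times> nat \<times> nat"

definition affine_chirotope :: "(nat \<Rightarrow> real^3) \<Rightarrow> nat \<times> nat \<times> nat \<times> nat \<Rightarrow> real" where
  "affine_chirotope x = (\<lambda>(i, j, k, l).
     sign_det (homogenize (x i)) (homogenize (x j)) (homogenize (x k)) (homogenize (x l)))"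

definition triple_normal :: "(nat \<Rightarrow> real^4) \<Rightarrow> idx3 \<Rightarrow> real^4" where
  "triple_normal v = (\<lambda>(i, j, k). unit_normal (v i) (v j) (v k))"

definition wedge_chirotope :: "(nat \<Rightarrow> real^4) \<Rightarrow> idx3 \<times> idx3 \<times> idx3 \<times> idx3 \<Rightarrow> real" where
  "wedge_chirotope v = (\<lambda>(I, J, K, L).
     sign_det (triple_normal v I) (triple_normal v J) (triple_normal v K) (triple_normal v L))"

type_synonym strong_geometry =
  "(nat \<times> nat \<times> nat \<times> nat \<Rightarrow> real) \<times> (idx3 \<times> idx3 \<times> idx3 \<times> idx3 \<Rightarrow> real)"

definition SGeom_Aff :: "(nat \<Rightarrow> real^3) \<Rightarrow> strong_geometry" where
  "SGeom_Aff x = (affine_chirotope x, wedge_chirotope (homogenize \<circ> x))"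

(* Both components are functions on index tuples with entries in {0, ..., n-1}; their values
   elsewhere are artefacts of totality and are not compared. *)
definition SGeom_isomorphic :: "nat \<Rightarrow> strong_geometry \<Rightarrow> strong_geometry \<Rightarrow> bool" where
  "SGeom_isomorphic n G G' \<longleftrightarrow>
     (let N = {..<n}; T = N \<times> N \<times> N in
       (\<forall>I \<in> N \<times> N \<times> N \<times> N. fst G I = fst G' I) \<and>
       (\<forall>J \<in> T \<times> T \<times> T \<times> T. snd G J = snd G' J))"

definition ambient_isotopic :: "'a::topological_space set \<Rightarrow> 'a set \<Rightarrow> bool" where
  "ambient_isotopic K L \<longleftrightarrow>
     (\<exists>H :: real \<times> 'a \<Rightarrow> 'a.
        continuous_on ({0..1} \<times> UNIV) H \<and>
        (\<forall>t\<in>{0..1}. \<exists>g. homeomorphism UNIV UNIV (\<lambda>x. H (t, x)) g) \<and>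
        (\<forall>x. H (0, x) = x) \<and>
        (\<lambda>x. H (1, x)) ` K = L)"

end

theory Submission
  imports Defs
begin

text \<open>
  A point $y$ of $\mathbf{R}^4$ has a sign vector with respect to the normals of the planes through
  the triples of points. Every $y$ is a sum, without sign cancellation, of vectors orthogonal to three
  independent normals, and the signs of those vectors are values of the wedge chirotope. So the wedge
  chirotope determines which sign vectors occur, and both plane arrangements have the same faces inside
  the convex hull of the points, which the affine chirotope cuts out. Coning from a chosen point in
  each face, by increasing dimension, gives a homeomorphism between the two hulls that preserves sign
  vectors, hence maps edges to edges. It extends radially to $\mathbf{R}^3$ and is affine and orientation
  preserving on a small simplex. Zooming in at a point of this simplex is an isotopy to a linear map of
  positive determinant, and such maps are isotopic to the identity.
\<close>

subsection \<open>Isotopies to the identity\<close>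

text \<open>The wedge chirotope sees only signs of linear forms on R^4, and the plane at infinity is
  not among its planes. A vector with prescribed signs may have first coordinate 0 or negative and
  then gives no point of R^3, so cells outside the hull may fail to correspond. Inside the hull the
  facet inequalities force that coordinate to be positive; so the cells are compared only there, and
  the outside is filled in along rays.

  Corresponding cells need not be affinely equivalent, but cones over faces already treated agree on
  common faces. A homeomorphism between the knots alone says nothing about isotopy, since a
  reflection carries a knot to its mirror image. The zoom needs an open set on which the map is
  affine. It is affine over the hull of the chosen points of an increasing chain of cells, and a
  full chain spans a simplex whose orientation the chirotope fixes.

  Three points do not span R^4 after homogenization and their wedge chirotope is zero, so that case
  is settled by an affine map.\<close>

definition isotopic_to_id :: "('a::topological_space \<Rightarrow> 'a) \<Rightarrow> bool" where
  "isotopic_to_id f \<longleftrightarrow>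
     (\<exists>H :: real \<times> 'a \<Rightarrow> 'a.
        continuous_on ({0..1} \<times> UNIV) H \<and>
        (\<forall>t\<in>{0..1}. \<exists>g. homeomorphism UNIV UNIV (\<lambda>x. H (t, x)) g) \<and>
        (\<forall>x. H (0, x) = x) \<and>
        (\<forall>x. H (1, x) = f x))"

lemma ambient_isotopic_image:
  assumes "isotopic_to_id f" "f ` K = L"
  shows "ambient_isotopic K L"
proof -
  obtain H :: "real \<times> 'a \<Rightarrow> 'a" where "continuous_on ({0..1} \<times> UNIV) H"
    "\<forall>t\<in>{0..1}. \<exists>g. homeomorphism UNIV UNIV (\<lambda>x. H (t, x)) g"
    "\<forall>x. H (0, x) = x" and H1: "\<forall>x. H (1, x) = f x"
    using assms(1) unfolding isotopic_to_id_def by blast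
  moreover have "(\<lambda>x. H (1, x)) ` K = L"
    using H1 assms(2) by simp
  ultimately show ?thesis
    unfolding ambient_isotopic_def by blast
qed

text \<open>Both isotopies run at the same time: each stage is a composite of homeomorphisms, and no
  time intervals have to be glued.\<close>

lemma isotopic_to_id_compose:
  assumes "isotopic_to_id f" "isotopic_to_id g"
  shows "isotopic_to_id (g \<circ> f)"
proof -
  obtain H :: "real \<times> 'a \<Rightarrow> 'a" where H: "continuous_on ({0..1} \<times> UNIV) H"
    "\<forall>t\<in>{0..1}. \<exists>g. homeomorphism UNIV UNIV (\<lambda>x. H (t, x)) g"
    "\<forall>x. H (0, x) = x" "\<forall>x. H (1, x) = f x"
    using assms(1) unfolding isotopic_to_id_def by blast
  obtain K :: "real \<times> 'a \<Rightarrow> 'a" where K: "continuous_on ({0..1} \<times> UNIV) K"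
    "\<forall>t\<in>{0..1}. \<exists>g. homeomorphism UNIV UNIV (\<lambda>x. K (t, x)) g"
    "\<forall>x. K (0, x) = x" "\<forall>x. K (1, x) = g x"
    using assms(2) unfolding isotopic_to_id_def by blast
  let ?L = "\<lambda>z. K (fst z, H z)"
  have "continuous_on ({0..1} \<times> UNIV) ?L"
    by (intro continuous_on_compose2[OF K(1)] continuous_intros H(1)) auto
  moreover have "\<exists>h. homeomorphism UNIV UNIV (\<lambda>x. ?L (t, x)) h" if "t \<in> {0..1}" for t
  proof -
    obtain h where h: "homeomorphism UNIV UNIV (\<lambda>x. H (t, x)) h"
      using H(2) \<open>t \<in> {0..1}\<close> by blast
    obtain k where k: "homeomorphism UNIV UNIV (\<lambda>x. K (t, x)) k"
      using K(2) \<open>t \<in> {0..1}\<close> by blast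
    show ?thesis
      using homeomorphism_compose[OF h k] by (auto simp: o_def)
  qed
  ultimately show ?thesis
    unfolding isotopic_to_id_def using H(3,4) K(3,4) by (intro exI[of _ ?L]) auto
qed

lemma isotopic_to_id_ident: "isotopic_to_id (\<lambda>x. x)"
  unfolding isotopic_to_id_def
  by (intro exI[of _ snd] conjI ballI exI[of _ "\<lambda>x. x"]) (auto intro: continuous_intros homeomorphism_ident)

lemma isotopic_to_id_translation:
  fixes b :: "'a::real_normed_vector"
  shows "isotopic_to_id (\<lambda>x. x + b)"
  unfolding isotopic_to_id_def
proof (intro exI[of _ "\<lambda>z. snd z + fst z *\<^sub>R b"] conjI ballI)
  fix t :: real
  show "\<exists>g. homeomorphism UNIV UNIV (\<lambda>x. snd (t, x) + fst (t, x) *\<^sub>R b) g"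
    by (intro exI[of _ "\<lambda>x. x - t *\<^sub>R b"] homeomorphismI) (auto intro!: continuous_intros)
qed (auto intro!: continuous_intros)

section \<open>Matrices of positive determinant\<close>

lemma matrix_inv_if_det_nz:
  fixes A :: "real^'n^'n"
  assumes "det A \<noteq> 0"
  shows "A ** matrix_inv A = mat 1" "matrix_inv A ** A = mat 1"
proof -
  have "\<exists>B. A ** B = mat 1 \<and> B ** A = mat 1"
    using assms invertible_det_nz[of A] by (simp add: invertible_def)
  then have "A ** matrix_inv A = mat 1 \<and> matrix_inv A ** A = mat 1"
    unfolding matrix_inv_def by (rule someI_ex)
  then show "A ** matrix_inv A = mat 1" "matrix_inv A ** A = mat 1"
    by auto
qed

lemma homeomorphism_matrix:
  fixes A :: "real^'n^'n"
  assumes "det A \<noteq> 0"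
  shows "homeomorphism UNIV UNIV ((*v) A) ((*v) (matrix_inv A))"
proof -
  have inv: "A ** matrix_inv A = mat 1" "matrix_inv A ** A = mat 1"
    using matrix_inv_if_det_nz[OF assms] by auto
  show ?thesis
    by (intro homeomorphismI)
      (auto simp: matrix_vector_mul_assoc inv intro!: linear_continuous_on matrix_vector_mul_bounded_linear)
qed

text \<open>Dividing the path by B makes it start at the identity; that isotopy ends at A B^-1 and
  is composed with the one for B.\<close>

lemma isotopic_to_id_matrix_path:
  fixes A B :: "real^'n^'n"
  assumes nz: "\<And>t. 0 \<le> t \<Longrightarrow> t \<le> 1 \<Longrightarrow> det ((1 - t) *\<^sub>R B + t *\<^sub>R A) \<noteq> 0"
    and B: "isotopic_to_id ((*v) B)"
  shows "isotopic_to_id ((*v) A)"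
proof -
  have dB: "det B \<noteq> 0"
    using nz[of 0] by simp
  have inv: "B ** matrix_inv B = mat 1" "matrix_inv B ** B = mat 1"
    using matrix_inv_if_det_nz[OF dB] by auto
  have path: "((1 - t) *\<^sub>R B + t *\<^sub>R A) *v y = (1 - t) *\<^sub>R (B *v y) + t *\<^sub>R (A *v y)" for t y
    by (simp add: matrix_vector_mult_add_rdistrib scaleR_matrix_vector_assoc)
  let ?H = "\<lambda>z. (1 - fst z) *\<^sub>R (B *v (matrix_inv B *v snd z)) + fst z *\<^sub>R (A *v (matrix_inv B *v snd z))"
  have "isotopic_to_id (\<lambda>x. A *v (matrix_inv B *v x))"
    unfolding isotopic_to_id_def
  proof (intro exI[of _ ?H] conjI ballI)
    show "continuous_on ({0..1} \<times> UNIV) ?H"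
      by (intro continuous_intros bounded_linear.continuous_on[OF matrix_vector_mul_bounded_linear])
  next
    fix t :: real assume t: "t \<in> {0..1}"
    have "homeomorphism UNIV UNIV ((*v) (matrix_inv B)) ((*v) B)"
      using homeomorphism_matrix[OF dB] homeomorphism_symD by blast
    moreover have "homeomorphism UNIV UNIV ((*v) ((1 - t) *\<^sub>R B + t *\<^sub>R A)) ((*v) (matrix_inv ((1 - t) *\<^sub>R B + t *\<^sub>R A)))"
      using nz t by (intro homeomorphism_matrix) auto
    ultimately have "homeomorphism UNIV UNIV (((*v) ((1 - t) *\<^sub>R B + t *\<^sub>R A)) \<circ> ((*v) (matrix_inv B)))
      ((*v) B \<circ> (*v) (matrix_inv ((1 - t) *\<^sub>R B + t *\<^sub>R A)))"
      by (rule homeomorphism_compose)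
    then show "\<exists>g. homeomorphism UNIV UNIV (\<lambda>x. ?H (t, x)) g"
      by (auto simp: o_def path)
  qed (auto simp: matrix_vector_mul_assoc inv)
  from isotopic_to_id_compose[OF B this]
  have "isotopic_to_id (\<lambda>x. A *v (matrix_inv B *v (B *v x)))"
    by (simp add: o_def)
  moreover have "A *v (matrix_inv B *v (B *v x)) = A *v x" for x
    by (simp only: matrix_vector_mul_assoc[of "matrix_inv B"] inv matrix_vector_mul_lid)
  ultimately show ?thesis by simp
qed

context
  fixes P :: "real^3 \<Rightarrow> real^3 \<Rightarrow> real^3 \<Rightarrow> bool"
  defines "P a b c \<equiv> isotopic_to_id ((*v) (vector [a, b, c] :: real^3^3))"
begin

text \<open>The determinant is affine in each row, so the segment between two such matrices stays in the positive component.\<close>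

lemma isotopic_to_id_rows_step:
  fixes a b c a' b' c' :: "real^3"
  assumes "P a' b' c'" "det (vector [a, b, c] :: real^3^3) > 0" "det (vector [a', b', c'] :: real^3^3) > 0"
    and one: "(b = b' \<and> c = c') \<or> (a = a' \<and> c = c') \<or> (a = a' \<and> b = b')"
  shows "P a b c"
  unfolding P_def
proof (rule isotopic_to_id_matrix_path)
  show "isotopic_to_id ((*v) (vector [a', b', c'] :: real^3^3))"
    using assms(1) by (simp add: P_def)
  fix t :: real assume t: "0 \<le> t" "t \<le> 1"
  have "det ((1 - t) *\<^sub>R (vector [a', b', c'] :: real^3^3) + t *\<^sub>R vector [a, b, c])
    = (1 - t) * det (vector [a', b', c'] :: real^3^3) + t * det (vector [a, b, c] :: real^3^3)"
    using one by (elim disjE) (simp_all add: det_3 algebra_simps)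
  also have "\<dots> > 0"
  proof (cases "t = 0")
    case False
    then show ?thesis
      using t assms(2,3) by (intro add_nonneg_pos) auto
  qed (use assms in simp)
  finally show "det ((1 - t) *\<^sub>R (vector [a', b', c'] :: real^3^3) + t *\<^sub>R vector [a, b, c]) \<noteq> 0"
    by simp
qed

text \<open>With first row e1 the determinant is a 2 by 2 minor of b and c. Changing one row at a
  time, e2 and e3 reach every positive pair with c$3 > 0, and from there every one with b$2 > 0. If
  b$3 is nonzero, adding a multiple of b to c keeps the determinant and brings c$3 to 1.\<close>

lemma isotopic_to_id_rows1: 
  assumes "0 < det (vector [vector [1, 0, 0], b, c] :: real^3^3)"
  shows "P (vector [1, 0, 0]) b c"
proof -
  let ?e1 = "vector [1, 0, 0] :: real^3" and ?e2 = "vector [0, 1, 0] :: real^3" and ?e3 = "vector [0, 0, 1] :: real^3"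
  have e: "P ?e1 ?e2 ?e3"
  proof -
    have "vector [?e1, ?e2, ?e3] = (mat 1 :: real^3^3)"
      by (simp add: vec_eq_iff forall_3 mat_def)
    then show ?thesis
      by (simp add: P_def isotopic_to_id_ident matrix_vector_mul_lid[abs_def])
  qed
  have c3: "P ?e1 b c" if "0 < det (vector [?e1, b, c] :: real^3^3)" "c$3 > 0" for b c
  proof -
    have "P ?e1 ?e2 c"
      using isotopic_to_id_rows_step[OF e, of ?e1 ?e2 c] that by (simp add: det_3)
    then show ?thesis
      by (rule isotopic_to_id_rows_step) (use that in \<open>simp_all add: det_3\<close>)
  qed
  have b2: "P ?e1 b c" if "0 < det (vector [?e1, b, c] :: real^3^3)" "b$2 > 0" for b c
    by (rule isotopic_to_id_rows_step[OF c3[of b ?e3]]) (use that in \<open>simp_all add: det_3\<close>)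
  show ?thesis
  proof (cases "b$3 = 0")
    case False
    define c' where "c' = c + ((1 - c$3) / b$3) *\<^sub>R b"
    have d: "det (vector [?e1, b, c'] :: real^3^3) = det (vector [?e1, b, c] :: real^3^3)"
      by (simp add: det_3 c'_def algebra_simps)
    have "c'$3 = 1"
      using False by (simp add: c'_def)
    then have "P ?e1 b c'"
      using d assms by (intro c3) auto
    then show ?thesis
      by (rule isotopic_to_id_rows_step) (use d assms in auto)
  next
    case True
    show ?thesis
    proof (cases "b$2 > 0")
      case False
      then have "b$2 < 0"
        using True assms by (cases "b$2 = 0") (auto simp: det_3)
      \<comment> \<open>Up to its first entry, b is a negative multiple of e2, half a turn away. The
        row (0, 1, -1) forms a positive pair both with (0, 1, -3), whose second entry is positive,
        and with b.\<close>
      moreover have "P ?e1 (vector [0, 1, -3]) (vector [0, 1, -1])"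
        by (rule b2) (simp_all add: det_3)
      then have "P ?e1 b (vector [0, 1, -1])"
        by (rule isotopic_to_id_rows_step) (use True \<open>b$2 < 0\<close> in \<open>simp_all add: det_3\<close>)
      then show ?thesis
        by (rule isotopic_to_id_rows_step) (use True \<open>b$2 < 0\<close> assms in \<open>simp_all add: det_3\<close>)
    qed (use b2 assms in auto)
  qed
qed

text \<open>Expand along the first column. If the minor of b and c is positive, a can be moved to
  e1. If another minor is nonzero, adding a multiple of a to b or c keeps the determinant and makes
  the first minor 1. If both others vanish, the first does not, and a + c in place of a makes the
  minor of a and b nonzero.\<close>

lemma isotopic_to_id_rows:
  assumes "0 < det (vector [a, b, c] :: real^3^3)"
  shows "P a b c"
proof -
  let ?e1 = "vector [1, 0, 0] :: real^3"
  have bc: "P a b c" if "0 < det (vector [a, b, c] :: real^3^3)" "b$2 * c$3 - b$3 * c$2 > 0" for a b c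
    by (rule isotopic_to_id_rows_step[OF isotopic_to_id_rows1[of b c]]) (use that in \<open>simp_all add: det_3\<close>)
  have ac: "P a b c" if pos: "0 < det (vector [a, b, c] :: real^3^3)" and nz: "a$2 * c$3 - a$3 * c$2 \<noteq> 0" for a b c
  proof -
    define s where "s = (1 - (b$2 * c$3 - b$3 * c$2)) / (a$2 * c$3 - a$3 * c$2)"
    define b' where "b' = b + s *\<^sub>R a"
    have "s * (a$2 * c$3 - a$3 * c$2) = 1 - (b$2 * c$3 - b$3 * c$2)"
      using nz by (simp add: s_def)
    then have "b'$2 * c$3 - b'$3 * c$2 = 1"
      by (simp add: b'_def algebra_simps)
    moreover have d: "det (vector [a, b', c] :: real^3^3) = det (vector [a, b, c] :: real^3^3)"
      by (simp add: det_3 b'_def algebra_simps)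
    ultimately have "P a b' c"
      using pos by (intro bc) auto
    then show ?thesis
      by (rule isotopic_to_id_rows_step) (use d pos in auto)
  qed
  have ab: "P a b c" if pos: "0 < det (vector [a, b, c] :: real^3^3)" and nz: "a$2 * b$3 - a$3 * b$2 \<noteq> 0" for a b c
  proof -
    define s where "s = (1 - (b$2 * c$3 - b$3 * c$2)) / (b$2 * a$3 - b$3 * a$2)"
    define c' where "c' = c + s *\<^sub>R a"
    have "b$2 * a$3 - b$3 * a$2 \<noteq> 0"
      using nz by (simp add: mult.commute)
    then have "s * (b$2 * a$3 - b$3 * a$2) = 1 - (b$2 * c$3 - b$3 * c$2)"
      by (simp add: s_def)
    then have "b$2 * c'$3 - b$3 * c'$2 = 1"
      by (simp add: c'_def algebra_simps)
    moreover have d: "det (vector [a, b, c'] :: real^3^3) = det (vector [a, b, c] :: real^3^3)"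
      by (simp add: det_3 c'_def algebra_simps)
    ultimately have "P a b c'"
      using pos by (intro bc) auto
    then show ?thesis
      by (rule isotopic_to_id_rows_step) (use d pos in auto)
  qed
  show ?thesis
  proof (cases "a$2 * c$3 - a$3 * c$2 = 0 \<and> a$2 * b$3 - a$3 * b$2 = 0")
    case True
    define a' where "a' = a + c"
    have d: "det (vector [a', b, c] :: real^3^3) = det (vector [a, b, c] :: real^3^3)"
      by (simp add: det_3 a'_def algebra_simps)
    have "det (vector [a, b, c] :: real^3^3) = a$1 * (b$2 * c$3 - b$3 * c$2)
       - b$1 * (a$2 * c$3 - a$3 * c$2) + c$1 * (a$2 * b$3 - a$3 * b$2)"
      by (simp add: det_3 algebra_simps)
    then have "b$2 * c$3 - b$3 * c$2 \<noteq> 0"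
      using True assms by auto
    moreover have "a'$2 * b$3 - a'$3 * b$2 = (a$2 * b$3 - a$3 * b$2) - (b$2 * c$3 - b$3 * c$2)"
      by (simp add: a'_def algebra_simps)
    ultimately have "a'$2 * b$3 - a'$3 * b$2 \<noteq> 0"
      using True by simp
    then have "P a' b c"
      using assms d by (intro ab) auto
    then show ?thesis
      by (rule isotopic_to_id_rows_step) (use d assms in auto)
  qed (use ab ac assms in blast)
qed

end

lemma isotopic_to_id_matrix:
  fixes A :: "real^3^3"
  assumes "det A > 0"
  shows "isotopic_to_id ((*v) A)"
proof -
  have A: "A = vector [A$1, A$2, A$3]"
    by (simp add: vec_eq_iff forall_3)
  then have "isotopic_to_id ((*v) (vector [A$1, A$2, A$3] :: real^3^3))"
    using assms by (intro isotopic_to_id_rows) simp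
  then show ?thesis
    using A by simp
qed

text \<open>After translations and division by A the map becomes a homeomorphism G that is the
  identity on a ball about 0. Then G (t x) / t is G at t = 1 and equals x as soon as t x lies in the
  ball, so it extends by the identity to t = 0.\<close>

lemma isotopic_to_id_if_locally_affine:
  fixes F :: "real^3 \<Rightarrow> real^3" and A :: "real^3^3"
  assumes F: "homeomorphism UNIV UNIV F F'"
    and U: "open U" "b \<in> U" and affine: "\<And>x. x \<in> U \<Longrightarrow> F x = F b + A *v (x - b)"
    and A: "det A > 0"
  shows "isotopic_to_id F"
proof -
  define B where "B = matrix_inv A"
  have inv: "A ** B = mat 1" "B ** A = mat 1"
    using matrix_inv_if_det_nz[of A] A by (auto simp: B_def)
  define G where "G = (\<lambda>x. B *v (F (x + b) - F b))"
  have contF: "continuous_on UNIV F"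
    using F by (simp add: homeomorphism_def)
  have homG: "homeomorphism UNIV UNIV G (\<lambda>y. F' (A *v y + F b) - b)"
  proof -
    have F': "continuous_on UNIV F'" "\<And>x. F' (F x) = x" "\<And>x. F (F' x) = x"
      using F by (auto simp: homeomorphism_def)
    have "continuous_on UNIV (\<lambda>x. F (x + b))"
      by (rule continuous_on_compose2[OF contF]) (auto intro!: continuous_intros)
    then have "continuous_on UNIV G"
      unfolding G_def
      by (intro bounded_linear.continuous_on[OF matrix_vector_mul_bounded_linear] continuous_intros)
    moreover have "continuous_on UNIV (\<lambda>y. A *v y + F b)"
      by (intro bounded_linear.continuous_on[OF matrix_vector_mul_bounded_linear] continuous_intros)
    then have "continuous_on UNIV (\<lambda>y. F' (A *v y + F b) - b)"
      by (intro continuous_on_diff continuous_on_compose2[OF F'(1)] continuous_on_const) auto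
    moreover have "A *v (B *v x) = x" "B *v (A *v x) = x" for x
      by (simp_all add: matrix_vector_mul_assoc inv)
    ultimately show ?thesis
      by (intro homeomorphismI) (auto simp: G_def F')
  qed
  have contG: "continuous_on UNIV G"
    using homG by (simp add: homeomorphism_def)
  obtain \<delta> where \<delta>: "\<delta> > 0" "ball b \<delta> \<subseteq> U"
    using U openE by blast
  have Gid: "G x = x" if "norm x < \<delta>" for x
  proof -
    have "x + b \<in> U"
      using that \<delta>(2) by (auto simp: dist_norm subset_iff)
    then show ?thesis
      by (simp add: G_def affine matrix_vector_mul_assoc inv)
  qed
  let ?H = "\<lambda>(t, x). if t = 0 then x else (1 / t) *\<^sub>R G (t *\<^sub>R x)"
  have "isotopic_to_id G"
    unfolding isotopic_to_id_def
  proof (intro exI[of _ ?H] conjI ballI)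
    let ?S = "({0..1} \<times> UNIV) :: (real \<times> (real^3)) set"
    \<comment> \<open>Joint continuity at t = 0: where t x is short the family is the projection to
      x, and together with t > 0 these relatively open sets cover everything.\<close>
    let ?V = "{z \<in> ?S. norm (fst z *\<^sub>R snd z) < \<delta>}" and ?W = "{z \<in> ?S. fst z > 0}"
    have V: "openin (top_of_set ?S) ?V"
    proof -
      have "openin (top_of_set ?S) (?S \<inter> (\<lambda>z. norm (fst z *\<^sub>R snd z)) -` {..<\<delta>})"
        by (rule continuous_openin_preimage_gen) (auto intro!: continuous_intros)
      then show ?thesis
        by (simp add: vimage_def Int_def)
    qed
    have W: "openin (top_of_set ?S) ?W"
    proof -
      have "openin (top_of_set ?S) (?S \<inter> fst -` {0<..})"
        by (rule continuous_openin_preimage_gen) (auto intro!: continuous_intros)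
      then show ?thesis
        by (simp add: vimage_def Int_def)
    qed
    have "continuous_on ?V ?H"
    proof (rule continuous_on_eq[of _ snd])
      fix z assume "z \<in> ?V"
      then show "snd z = ?H z"
        using Gid[of "fst z *\<^sub>R snd z"] by (auto simp: split_beta)
    qed (intro continuous_intros)
    moreover have "continuous_on ?W ?H"
    proof (rule continuous_on_eq[of _ "\<lambda>z. (1 / fst z) *\<^sub>R G (fst z *\<^sub>R snd z)"])
      show "continuous_on ?W (\<lambda>z. (1 / fst z) *\<^sub>R G (fst z *\<^sub>R snd z))"
        by (intro continuous_intros continuous_on_compose2[OF contG]) auto
    qed auto
    ultimately have "continuous_on (?V \<union> ?W) ?H"
      using V W by (intro continuous_on_Un_local_open) (auto intro: openin_subset_trans)
    moreover have "?V \<union> ?W = ?S"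
      using \<delta> by (auto simp: less_eq_real_def)
    ultimately show "continuous_on ?S ?H" by metis
  next
    fix t :: real assume "t \<in> {0..1}"
    show "\<exists>g. homeomorphism UNIV UNIV (\<lambda>x. ?H (t, x)) g"
    proof (cases "t = 0")
      case True
      then show ?thesis
        by (auto intro: homeomorphism_ident)
    next
      case False
      obtain G' where G': "continuous_on UNIV G'" "\<And>x. G' (G x) = x" "\<And>x. G (G' x) = x"
        using homG by (auto simp: homeomorphism_def)
      have "homeomorphism UNIV UNIV (\<lambda>x. (1 / t) *\<^sub>R G (t *\<^sub>R x)) (\<lambda>y. (1 / t) *\<^sub>R G' (t *\<^sub>R y))"
        using False by (intro homeomorphismI)
          (auto simp: G' intro!: continuous_intros continuous_on_compose2[OF contG] continuous_on_compose2[OF G'(1)])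
      then show ?thesis
        using False by auto
    qed
  qed auto
  moreover have "F = (\<lambda>x. x + F b) \<circ> (*v) A \<circ> G \<circ> (\<lambda>x. x + (- b))"
    by (auto simp: G_def matrix_vector_mul_assoc inv)
  ultimately show ?thesis
    using isotopic_to_id_matrix[OF A] isotopic_to_id_translation isotopic_to_id_compose by metis
qed

subsection \<open>Covectors in dimension four\<close>

lemma det_4:
  "det (A :: 'a::comm_ring_1^4^4) =
    A$1$1 * (A$2$2 * (A$3$3 * A$4$4 - A$3$4 * A$4$3) - A$2$3 * (A$3$2 * A$4$4 - A$3$4 * A$4$2)
      + A$2$4 * (A$3$2 * A$4$3 - A$3$3 * A$4$2))
  - A$1$2 * (A$2$1 * (A$3$3 * A$4$4 - A$3$4 * A$4$3) - A$2$3 * (A$3$1 * A$4$4 - A$3$4 * A$4$1)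
      + A$2$4 * (A$3$1 * A$4$3 - A$3$3 * A$4$1))
  + A$1$3 * (A$2$1 * (A$3$2 * A$4$4 - A$3$4 * A$4$2) - A$2$2 * (A$3$1 * A$4$4 - A$3$4 * A$4$1)
      + A$2$4 * (A$3$1 * A$4$2 - A$3$2 * A$4$1))
  - A$1$4 * (A$2$1 * (A$3$2 * A$4$3 - A$3$3 * A$4$2) - A$2$2 * (A$3$1 * A$4$3 - A$3$3 * A$4$1)
      + A$2$3 * (A$3$1 * A$4$2 - A$3$2 * A$4$1))"
proof -
  have f: "finite {2::4, 3, 4}" "1 \<notin> {2::4, 3, 4}" "finite {3::4, 4}" "2 \<notin> {3::4, 4}"
    "finite {4::4}" "3 \<notin> {4::4}"
    by auto
  show ?thesis
    unfolding det_def UNIV_4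
    unfolding sum_over_permutations_insert[OF f(1,2)]
    unfolding sum_over_permutations_insert[OF f(3,4)]
    unfolding sum_over_permutations_insert[OF f(5,6)]
    unfolding permutes_sing
    by (simp add: sign_swap_id permutation_swap_id permutation_compose sign_compose sign_id swap_id_eq algebra_simps)
qed

lemmas det4_expand = det4_def det_4

text \<open>The generalized cross product: the vector that represents the linear form
  \<open>det4 a b c\<close>.\<close>

definition cross4 :: "real^4 \<Rightarrow> real^4 \<Rightarrow> real^4 \<Rightarrow> real^4" where
  "cross4 a b c = (\<chi> i. det4 a b c (axis i 1))"

lemma inner_cross4: "cross4 a b c \<bullet> d = det4 a b c d"
  by (simp add: cross4_def inner_vec_def sum_4 det4_expand axis_def algebra_simps)

lemma det4_repeat [simp]:
  "det4 a a c d = 0" "det4 a b a d = 0" "det4 a b c a = 0" "det4 a b b d = 0" "det4 a b c b = 0" "det4 a b c c = 0"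
  by (simp_all add: det4_expand algebra_simps)

lemma cross4_orthogonal [simp]:
  "cross4 a b c \<bullet> a = 0" "cross4 a b c \<bullet> b = 0" "cross4 a b c \<bullet> c = 0"
  "a \<bullet> cross4 a b c = 0" "b \<bullet> cross4 a b c = 0" "c \<bullet> cross4 a b c = 0"
  by (simp_all add: inner_cross4 inner_commute[of _ "cross4 a b c"])

lemma cross4_swap: "cross4 b a c = - cross4 a b c"
  by (simp add: cross4_def vec_eq_iff det4_expand algebra_simps)

lemma det4_scaleR: "det4 (p *\<^sub>R a) (q *\<^sub>R b) (r *\<^sub>R c) (s *\<^sub>R d) = p * q * r * s * det4 a b c d"
  by (simp add: det4_expand algebra_simps)

lemma det4_nz_iff:
  "det4 a b c d \<noteq> 0 \<longleftrightarrow> (\<forall>x. a \<bullet> x = 0 \<and> b \<bullet> x = 0 \<and> c \<bullet> x = 0 \<and> d \<bullet> x = 0 \<longrightarrow> x = 0)"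
proof -
  let ?A = "vector [a, b, c, d] :: real^4^4"
  have "det4 a b c d \<noteq> 0 \<longleftrightarrow> inj ((*v) ?A)"
    using det_nz_iff_inj[of "(*v) ?A"] by (simp add: det4_def)
  also have "\<dots> \<longleftrightarrow> (\<forall>x. ?A *v x = 0 \<longrightarrow> x = 0)"
    by (rule linear_injective_0[OF matrix_vector_mul_linear])
  finally show ?thesis
    by (simp add: vec_eq_iff[of "?A *v _"] forall_4 matrix_vector_mul_component)
qed

lemma det4_basis:
  assumes "det4 a b c d \<noteq> 0"
  shows "\<exists>p q r s. y = p *\<^sub>R a + q *\<^sub>R b + r *\<^sub>R c + s *\<^sub>R d"
proof -
  have "span {a, b, c, d} = UNIV"
  proof (rule ccontr)
    assume "span {a, b, c, d} \<noteq> UNIV"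
    then obtain x where "x \<noteq> 0" "\<And>y. y \<in> span {a, b, c, d} \<Longrightarrow> orthogonal x y"
      using orthogonal_to_subspace_exists_gen[of "{a, b, c, d}" UNIV] by auto
    then show False
      using assms by (auto simp: det4_nz_iff orthogonal_def span_base inner_commute)
  qed
  then have "y \<in> span {a, b, c, d}" by simp
  then obtain p q r s where "y - p *\<^sub>R a - q *\<^sub>R b - r *\<^sub>R c - s *\<^sub>R d = 0"
    by (auto simp: span_insert)
  then show ?thesis
    by (intro exI[of _ p] exI[of _ q] exI[of _ r] exI[of _ s]) (simp add: algebra_simps)
qed

section \<open>Conformal sums of cocircuits\<close>

lemma span_eq_UNIV_iff_orthogonal:
  fixes V :: "'a::euclidean_space set"
  shows "span V = UNIV \<longleftrightarrow> (\<forall>x. (\<forall>v\<in>V. v \<bullet> x = 0) \<longrightarrow> x = 0)"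
proof
  assume V: "span V = UNIV"
  show "\<forall>x. (\<forall>v\<in>V. v \<bullet> x = 0) \<longrightarrow> x = 0"
  proof (intro allI impI)
    fix x assume "\<forall>v\<in>V. v \<bullet> x = 0"
    then have "orthogonal x x"
      using V by (intro orthogonal_to_span[of x V]) (auto simp: orthogonal_def inner_commute)
    then show "x = 0"
      by (simp add: orthogonal_def)
  qed
next
  assume *: "\<forall>x. (\<forall>v\<in>V. v \<bullet> x = 0) \<longrightarrow> x = 0"
  show "span V = UNIV"
  proof (rule ccontr)
    assume "span V \<noteq> UNIV"
    then obtain x where "x \<noteq> 0" "\<And>y. y \<in> span V \<Longrightarrow> orthogonal x y"
      using orthogonal_to_subspace_exists_gen[of V UNIV] by auto
    then show False
      using * by (metis inner_commute orthogonal_def span_base)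
  qed
qed

text \<open>
  If the zero set of $y$ has rank less than three, it is orthogonal to some $d$ not parallel to $y$.
  With $m < M$ the extreme values of the ratios $(v \cdot d) / (v \cdot y)$, the vectors $M y - d$ and
  $d - m y$ have the signs of $y$ or $0$, have more zeros than $y$, and add up to $(M - m) y$.
\<close>

lemma cocircuit_induct:
  fixes V :: "(real^4) set"
  assumes fin: "finite V" and V: "span V = UNIV"
    and base: "\<And>k a b c. a \<in> V \<Longrightarrow> b \<in> V \<Longrightarrow> c \<in> V \<Longrightarrow> Q (k *\<^sub>R cross4 a b c)"
    and sum: "\<And>r s. Q r \<Longrightarrow> Q s \<Longrightarrow> (\<And>v. v \<in> V \<Longrightarrow> 0 \<le> (v \<bullet> r) * (v \<bullet> s)) \<Longrightarrow> Q (r + s)"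
  shows "Q y"
proof (induction "card {v \<in> V. v \<bullet> y \<noteq> 0}" arbitrary: y rule: less_induct)
  case less
  have V0: "x = 0" if "\<And>v. v \<in> V \<Longrightarrow> v \<bullet> x = 0" for x
    using V that by (auto simp: span_eq_UNIV_iff_orthogonal)
  let ?Z = "{v \<in> V. v \<bullet> y = 0}" and ?N = "{v \<in> V. v \<bullet> y \<noteq> 0}"
  show ?case
  proof (cases "y = 0")
    case True
    have "V \<noteq> {}"
      using V0[of "axis 1 1"] by (auto simp: axis_eq_0_iff)
    then show ?thesis
      using True base[of _ _ _ 0] by auto
  next
    case False
    show ?thesis
    proof (cases "\<exists>d. (\<forall>v\<in>?Z. v \<bullet> d = 0) \<and> d \<notin> span {y}")
      case True
      then obtain d where d: "\<And>v. v \<in> ?Z \<Longrightarrow> v \<bullet> d = 0" "d \<notin> span {y}" by blast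
      define \<rho> where "\<rho> = (\<lambda>v. (v \<bullet> d) / (v \<bullet> y))"
      define M where "M = Max (\<rho> ` ?N)"
      define m where "m = Min (\<rho> ` ?N)"
      have N: "finite (\<rho> ` ?N)" "\<rho> ` ?N \<noteq> {}"
        using fin V0[of y] False by auto
      have \<rho>: "m \<le> \<rho> v" "\<rho> v \<le> M" if "v \<in> ?N" for v
        using N that by (auto simp: m_def M_def)
      have vd: "v \<bullet> d = \<rho> v * (v \<bullet> y)" if "v \<in> V" for v
        using d(1)[of v] that by (cases "v \<bullet> y = 0") (auto simp: \<rho>_def)
      \<comment> \<open>Equal extremes would make d - M y orthogonal to all of V, hence d a multiple
        of y.\<close>
      have "m \<noteq> M"
      proof
        assume "m = M"
        then have "v \<bullet> (d - M *\<^sub>R y) = 0" if "v \<in> V" for v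
          using \<rho>[of v] vd[OF that] that by (cases "v \<bullet> y = 0") (auto simp: inner_diff_right)
        then have "d = M *\<^sub>R y"
          using V0[of "d - M *\<^sub>R y"] by simp
        then show False
          using d(2) by (simp add: span_base span_scale)
      qed
      then have mM: "m < M"
        using \<rho> N(2) by fastforce
      define r where "r = (1 / (M - m)) *\<^sub>R (M *\<^sub>R y - d)"
      define s where "s = (1 / (M - m)) *\<^sub>R (d - m *\<^sub>R y)"
      have vr: "v \<bullet> r = (M - \<rho> v) / (M - m) * (v \<bullet> y)" if "v \<in> V" for v
        using vd[OF that] by (simp add: r_def inner_diff_right left_diff_distrib)
      have vs: "v \<bullet> s = (\<rho> v - m) / (M - m) * (v \<bullet> y)" if "v \<in> V" for v
        using vd[OF that] by (simp add: s_def inner_diff_right left_diff_distrib)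
      have "M \<in> \<rho> ` ?N" "m \<in> \<rho> ` ?N"
        using N by (auto simp: M_def m_def simp del: image_is_empty intro: Max_in Min_in)
      then obtain v w where v: "v \<in> ?N" "\<rho> v = M" and w: "w \<in> ?N" "\<rho> w = m"
        by auto
      have "{v \<in> V. v \<bullet> r \<noteq> 0} \<subseteq> ?N" "v \<notin> {v \<in> V. v \<bullet> r \<noteq> 0}"
        using v vr by auto
      then have "{v \<in> V. v \<bullet> r \<noteq> 0} \<subset> ?N"
        using v(1) by blast
      then have "Q r"
        using fin by (intro less psubset_card_mono) auto
      moreover have "{v \<in> V. v \<bullet> s \<noteq> 0} \<subseteq> ?N" "w \<notin> {v \<in> V. v \<bullet> s \<noteq> 0}"
        using w vs by auto
      then have "{v \<in> V. v \<bullet> s \<noteq> 0} \<subset> ?N"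
        using w(1) by blast
      then have "Q s"
        using fin by (intro less psubset_card_mono) auto
      moreover have "0 \<le> (v \<bullet> r) * (v \<bullet> s)" if "v \<in> V" for v
      proof (cases "v \<bullet> y = 0")
        case False
        have "(v \<bullet> r) * (v \<bullet> s) = ((M - \<rho> v) * (\<rho> v - m)) * ((v \<bullet> y) / (M - m))\<^sup>2"
          by (simp add: vr[OF that] vs[OF that] power2_eq_square)
        also have "\<dots> \<ge> 0"
          using \<rho>[of v] False that by (intro mult_nonneg_nonneg) auto
        finally show ?thesis .
      qed (simp add: vr[OF that])
      ultimately have "Q (r + s)"
        by (rule sum)
      moreover have "r + s = y"
      proof -
        have "r + s = (1 / (M - m)) *\<^sub>R ((M - m) *\<^sub>R y)"
          unfolding r_def s_def scaleR_add_right[symmetric] by (simp add: algebra_simps)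
        then show ?thesis
          using mM by simp
      qed
      ultimately show ?thesis by simp
    next
      case line: False
      \<comment> \<open>Now everything orthogonal to the zero set is a multiple of y. So the zero
        set has rank three, and the cross product of a basis of it is a nonzero multiple of
        y.\<close>
      obtain B where B: "B \<subseteq> ?Z" "independent B" "?Z \<subseteq> span B"
        using maximal_independent_subset by blast
      have yB: "y \<notin> span B"
      proof
        assume "y \<in> span B"
        then have "orthogonal y y"
          using B(1) by (intro orthogonal_to_span[of y B]) (auto simp: orthogonal_def inner_commute)
        then show False
          using False by (simp add: orthogonal_def)
      qed
      have indep: "independent (insert y B)"
        using B(2) yB by (simp add: independent_insert)
      have "x = 0" if x: "\<And>v. v \<in> insert y B \<Longrightarrow> v \<bullet> x = 0" for x
      proof -
        have "orthogonal x v" if "v \<in> span B" for v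
          using x that by (intro orthogonal_to_span[of v B]) (auto simp: orthogonal_def inner_commute)
        then have "\<forall>v\<in>?Z. v \<bullet> x = 0"
          using B(3) by (auto simp: orthogonal_def inner_commute)
        then have "x \<in> span {y}"
          using line by blast
        then obtain k where "x = k *\<^sub>R y"
          by (auto simp: span_singleton)
        then show ?thesis
          using x[of y] False by auto
      qed
      then have "span (insert y B) = UNIV"
        by (auto simp: span_eq_UNIV_iff_orthogonal)
      then have "card (insert y B) = 4"
        using indep dim_eq_card_independent[of "insert y B"] dim_span[of "insert y B"] by simp
      then have "card B = 3"
        using card_insert_disjoint[of B y] yB span_base[of y B] independent_imp_finite[OF B(2)] by linarith
      then obtain a b c where abc: "B = {a, b, c}"
        by (auto simp: card_3_iff)
      then have abcV: "a \<in> V" "b \<in> V" "c \<in> V" "a \<bullet> y = 0" "b \<bullet> y = 0" "c \<bullet> y = 0"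
        using B(1) by auto
      have "det4 a b c y \<noteq> 0"
        using \<open>span (insert y B) = UNIV\<close> abc by (auto simp: det4_nz_iff span_eq_UNIV_iff_orthogonal)
      then have cy: "cross4 a b c \<bullet> y \<noteq> 0"
        by (simp add: inner_cross4)
      have "orthogonal (cross4 a b c) v" if "v \<in> span B" for v
        using that abc by (intro orthogonal_to_span[of v B]) (auto simp: orthogonal_def)
      then have "\<forall>v\<in>?Z. v \<bullet> cross4 a b c = 0"
        using B(3) by (auto simp: orthogonal_def inner_commute)
      then have "cross4 a b c \<in> span {y}"
        using line by blast
      then obtain k where k: "cross4 a b c = k *\<^sub>R y"
        by (auto simp: span_singleton)
      then have "k \<noteq> 0"
        using cy by auto
      then have "y = (1 / k) *\<^sub>R cross4 a b c"
        by (simp add: k)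
      then show ?thesis
        using base[of a b c "1 / k"] abcV by simp
    qed
  qed
qed

text \<open>The sign of a sum is a function of the signs of the summands as long as these are not
  opposite; this is what conformality buys.\<close>

lemma sgn_add_conformal:
  fixes a b a' b' :: real
  assumes "sgn a = sgn a'" "sgn b = sgn b'" "0 \<le> a * b"
  shows "sgn (a + b) = sgn (a' + b')"
  using assms by (auto simp: sgn_if zero_le_mult_iff split: if_splits)

text \<open>Having a counterpart is the property in \<open>cocircuit_induct\<close>. A cross product
  corresponds to the one with the same indices and the same factor, because its signs on T are
  values of the chirotope; counterparts of conformal summands add up.\<close>

lemma same_covectors:
  fixes W W' :: "'i \<Rightarrow> real^4"
  assumes fin: "finite T" and W: "span (W ` T) = UNIV"
    and chi: "\<And>i j k l. i \<in> T \<Longrightarrow> j \<in> T \<Longrightarrow> k \<in> T \<Longrightarrow> l \<in> T \<Longrightarrow>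
      sgn (det4 (W i) (W j) (W k) (W l)) = sgn (det4 (W' i) (W' j) (W' k) (W' l))"
  shows "\<exists>y'. \<forall>i\<in>T. sgn (W' i \<bullet> y') = sgn (W i \<bullet> y)"
proof (rule cocircuit_induct[of "W ` T" "\<lambda>y. \<exists>y'. \<forall>i\<in>T. sgn (W' i \<bullet> y') = sgn (W i \<bullet> y)"])
  fix k a b c assume "a \<in> W ` T" "b \<in> W ` T" "c \<in> W ` T"
  then obtain i j l where "i \<in> T" "j \<in> T" "l \<in> T" "a = W i" "b = W j" "c = W l" by auto
  then show "\<exists>y'. \<forall>i\<in>T. sgn (W' i \<bullet> y') = sgn (W i \<bullet> k *\<^sub>R cross4 a b c)"
    using chi by (intro exI[of _ "k *\<^sub>R cross4 (W' i) (W' j) (W' l)"])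
      (simp add: inner_commute[of "W _"] inner_commute[of "W' _"] inner_cross4 sgn_mult)
next
  fix r s assume "\<exists>r'. \<forall>i\<in>T. sgn (W' i \<bullet> r') = sgn (W i \<bullet> r)" "\<exists>s'. \<forall>i\<in>T. sgn (W' i \<bullet> s') = sgn (W i \<bullet> s)"
    and conf: "\<And>v. v \<in> W ` T \<Longrightarrow> 0 \<le> (v \<bullet> r) * (v \<bullet> s)"
  then obtain r' s' where rs: "\<And>i. i \<in> T \<Longrightarrow> sgn (W' i \<bullet> r') = sgn (W i \<bullet> r)" "\<And>i. i \<in> T \<Longrightarrow> sgn (W' i \<bullet> s') = sgn (W i \<bullet> s)"
    by blast
  have "sgn (W' i \<bullet> (r' + s')) = sgn (W i \<bullet> (r + s))" if "i \<in> T" for i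
    using sgn_add_conformal[OF rs(1)[OF that, symmetric] rs(2)[OF that, symmetric]] conf[of "W i"] that
    by (simp add: inner_add_right)
  then show "\<exists>y'. \<forall>i\<in>T. sgn (W' i \<bullet> y') = sgn (W i \<bullet> (r + s))"
    by blast
qed (use fin W in auto)

text \<open>Passing to \<open>cross4\<close> removes the definite description and the normalization
  at the price of a positive factor, which no sign notices. For dependent triples both vectors are 0
  and the factor is taken to be 1.\<close>

lemma unit_normal_cross4: "\<exists>r>0. unit_normal a b c = r *\<^sub>R cross4 a b c"
proof (cases "cross4 a b c = 0")
  case True
  have "\<not> (distinct [a, b, c] \<and> independent {a, b, c})"
  proof
    assume abc: "distinct [a, b, c] \<and> independent {a, b, c}"
    then have "dim {a, b, c} = 3"
      by (subst dim_eq_card_independent) auto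
    then have "dim (span {a, b, c}) \<noteq> dim (UNIV :: (real^4) set)"
      by simp
    then have "span {a, b, c} \<noteq> UNIV"
      by metis
    then obtain x where x: "x \<noteq> 0" "a \<bullet> x = 0" "b \<bullet> x = 0" "c \<bullet> x = 0"
      by (auto simp: span_eq_UNIV_iff_orthogonal)
    \<comment> \<open>x completes a, b, c to a basis: a further nonzero z orthogonal to all four
      would give five independent vectors.\<close>
    have "det4 a b c x \<noteq> 0"
      unfolding det4_nz_iff
    proof (intro allI impI)
      fix z assume z: "a \<bullet> z = 0 \<and> b \<bullet> z = 0 \<and> c \<bullet> z = 0 \<and> x \<bullet> z = 0"
      show "z = 0"
      proof (rule ccontr)
        assume "z \<noteq> 0"
        have o: "orthogonal v w" if "v \<in> {x, z}" "w \<in> span {a, b, c}" for v w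
          using that x z by (intro orthogonal_to_span[of w "{a, b, c}"]) (auto simp: orthogonal_def inner_commute)
        have "x \<notin> span {a, b, c}"
          using o[of x x] x by (auto simp: orthogonal_def)
        then have i1: "independent {x, a, b, c}" "x \<notin> {a, b, c}"
          using abc by (auto simp: independent_insert span_base)
        have "z \<notin> span {x, a, b, c}"
        proof
          assume "z \<in> span {x, a, b, c}"
          then have "orthogonal z z"
            using x z by (intro orthogonal_to_span[of z "{x, a, b, c}"]) (auto simp: orthogonal_def inner_commute)
          then show False
            using \<open>z \<noteq> 0\<close> by (simp add: orthogonal_def)
        qed
        then have i2: "independent {z, x, a, b, c}" "z \<notin> {x, a, b, c}"
          using i1 by (auto simp: independent_insert span_base)
        have "card {z, x, a, b, c} = 5"
          using i1(2) i2(2) abc by auto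
        moreover have "card {z, x, a, b, c} \<le> 4"
          using independent_bound[OF i2(1)] by simp
        ultimately show False by simp
      qed
    qed
    then show False
      using True by (simp add: inner_cross4[symmetric])
  qed
  then show ?thesis
    using True by (intro exI[of _ 1]) (auto simp: unit_normal_def)
next
  case False
  let ?w = "cross4 a b c"
  have ww: "det4 a b c ?w > 0"
    using False by (simp add: inner_cross4[symmetric])
  have indep: "independent {a, b, c}" and dist: "distinct [a, b, c]"
  proof -
    have sp: "span {a, b, c, ?w} = UNIV"
      using ww det4_nz_iff[of a b c ?w] by (auto simp: span_eq_UNIV_iff_orthogonal)
    show "distinct [a, b, c]"
      using ww by auto
    have "card {a, b, c, ?w} \<le> 4"
      using card_length[of "[a, b, c, ?w]"] by simp
    then have "independent {a, b, c, ?w}"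
      using sp by (intro card_le_dim_spanning[of _ UNIV]) auto
    then show "independent {a, b, c}"
      by (rule independent_mono) auto
  qed
  have uniq: "u = (1 / norm ?w) *\<^sub>R ?w" if u: "norm u = 1" "orthogonal u a" "orthogonal u b" "orthogonal u c" "det4 a b c u > 0" for u
  proof -
    define k where "k = (u \<bullet> ?w) / (?w \<bullet> ?w)"
    have "u - k *\<^sub>R ?w = 0"
    proof -
      have "a \<bullet> (u - k *\<^sub>R ?w) = 0" "b \<bullet> (u - k *\<^sub>R ?w) = 0" "c \<bullet> (u - k *\<^sub>R ?w) = 0"
        using u by (auto simp: inner_diff_right orthogonal_def inner_commute)
      moreover have "?w \<bullet> (u - k *\<^sub>R ?w) = 0"
        using False by (simp add: inner_diff_right k_def inner_commute)
      ultimately show ?thesis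
        using ww det4_nz_iff[of a b c ?w] by auto
    qed
    then have uk: "u = k *\<^sub>R ?w" by simp
    have "k > 0"
      using u(5) False by (auto simp: k_def inner_cross4[symmetric] inner_commute)
    moreover have "\<bar>k\<bar> * norm ?w = 1"
      using u(1) uk by (metis norm_scaleR)
    ultimately show ?thesis
      using uk False by (simp add: field_simps)
  qed
  have "unit_normal a b c = (1 / norm ?w) *\<^sub>R ?w"
    unfolding unit_normal_def using indep dist
  proof (simp only: simp_thms if_True, intro the_equality)
    show "norm ((1 / norm ?w) *\<^sub>R ?w) = 1 \<and> orthogonal ((1 / norm ?w) *\<^sub>R ?w) a \<and> orthogonal ((1 / norm ?w) *\<^sub>R ?w) b \<and>
      orthogonal ((1 / norm ?w) *\<^sub>R ?w) c \<and> 0 < det4 a b c ((1 / norm ?w) *\<^sub>R ?w)"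
      using False by (simp add: orthogonal_def inner_cross4[symmetric])
  qed (use uniq in blast)
  then show ?thesis
    using False by (intro exI[of _ "1 / norm ?w"]) auto
qed

subsection \<open>Homeomorphisms of cell decompositions\<close>

text \<open>The value 0 off \<open>T\<close> makes equality of these functions the same as equality
  of signs on \<open>T\<close>.\<close>

definition sign_vector :: "'i set \<Rightarrow> ('i \<Rightarrow> 'a \<Rightarrow> real) \<Rightarrow> 'a \<Rightarrow> 'i \<Rightarrow> real" where
  "sign_vector T h p = (\<lambda>i. if i \<in> T then sgn (h i p) else 0)"

text \<open>The face order of oriented matroids: for nonempty cells of an arrangement, the first
  cell lies in the closure of the second.\<close>

definition face_le :: "('i \<Rightarrow> real) \<Rightarrow> ('i \<Rightarrow> real) \<Rightarrow> bool" where
  "face_le \<sigma> \<tau> \<longleftrightarrow> (\<forall>i. \<sigma> i = 0 \<or> \<sigma> i = \<tau> i)"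

lemma face_le_refl [simp]: "face_le \<sigma> \<sigma>"
  by (simp add: face_le_def)

lemma face_le_trans: "face_le \<rho> \<sigma> \<Longrightarrow> face_le \<sigma> \<tau> \<Longrightarrow> face_le \<rho> \<tau>"
  unfolding face_le_def by metis

text \<open>For affine h the weak inequalities describe an intersection of closed half-spaces,
  whence closed cells are closed and convex.\<close>

lemma face_le_sign_vector_iff:
  "face_le (sign_vector T h q) (sign_vector T h p) \<longleftrightarrow>
     (\<forall>i\<in>T. (0 \<le> h i p \<longrightarrow> 0 \<le> h i q) \<and> (h i p \<le> 0 \<longrightarrow> h i q \<le> 0))"
  unfolding face_le_def sign_vector_def by (auto simp: sgn_if split: if_splits) (smt (verit))+

text \<open>Going strictly up enlarges the set of nonzero signs, so an element with most of them is
  maximal.\<close>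

lemma ex_face_le_maximal:
  assumes "finite D" "D \<noteq> {}" "finite T" "D \<subseteq> range (sign_vector T h)"
  shows "\<exists>\<tau>\<in>D. \<forall>\<sigma>\<in>D. face_le \<tau> \<sigma> \<longrightarrow> \<sigma> = \<tau>"
proof -
  define f where "f = (\<lambda>\<sigma>. card {i \<in> T. \<sigma> i \<noteq> (0::real)})"
  have "Max (f ` D) \<in> f ` D"
    using assms by simp
  then obtain \<tau> where \<tau>: "\<tau> \<in> D" "f \<tau> = Max (f ` D)" by auto
  have "\<sigma> = \<tau>" if "\<sigma> \<in> D" "face_le \<tau> \<sigma>" for \<sigma>
  proof -
    have sub: "{i \<in> T. \<tau> i \<noteq> 0} \<subseteq> {i \<in> T. \<sigma> i \<noteq> 0}"
      using that(2) unfolding face_le_def by force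
    moreover have "f \<sigma> \<le> f \<tau>"
      using \<tau>(2) that(1) assms(1) by simp
    ultimately have "{i \<in> T. \<tau> i \<noteq> 0} = {i \<in> T. \<sigma> i \<noteq> 0}"
      using assms(3) by (intro card_seteq) (auto simp: f_def)
    moreover have "\<sigma> i = 0" "\<tau> i = 0" if "i \<notin> T" for i
      using assms(4) \<open>\<sigma> \<in> D\<close> \<tau>(1) that by (auto simp: sign_vector_def)
    ultimately have "\<sigma> i = \<tau> i" for i
      using that(2)[unfolded face_le_def, rule_format, of i] by (cases "i \<in> T") force+
    then show ?thesis by blast
  qed
  then show ?thesis
    using \<tau>(1) by blast
qed

text \<open>\<open>down\<close> says that P is a union of closed cells. \<open>affine\<close> is
  asked for all real u, since rays are followed beyond their second point.\<close>

locale cells =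
  fixes T :: "'i set" and h :: "'i \<Rightarrow> 'a::euclidean_space \<Rightarrow> real" and P :: "'a set"
  assumes finT: "finite T"
    and cont: "\<And>i. continuous_on UNIV (h i)"
    and affine: "\<And>i u p q. h i ((1 - u) *\<^sub>R p + u *\<^sub>R q) = (1 - u) * h i p + u * h i q"
    and bdd: "bounded P"
    and down: "\<And>p q. p \<in> P \<Longrightarrow> face_le (sign_vector T h q) (sign_vector T h p) \<Longrightarrow> q \<in> P"
begin

abbreviation "sv \<equiv> sign_vector T h"

lemma sv_combine:
  assumes "face_le (sv q) (sv p)" "0 \<le> u" "u < 1"
  shows "sv ((1 - u) *\<^sub>R p + u *\<^sub>R q) = sv p"
proof -
  have "sgn ((1 - u) * h i p + u * h i q) = sgn (h i p)" if "i \<in> T" for i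
  proof (cases "h i p" "0 :: real" rule: linorder_cases)
    case less
    then have "(1 - u) * h i p < 0" "u * h i q \<le> 0"
      using assms that by (auto simp: face_le_sign_vector_iff mult_less_0_iff mult_nonneg_nonpos)
    then show ?thesis using less by (simp add: sgn_if)
  next
    case equal
    then have "h i q = 0"
      using assms(1) that by (force simp: face_le_sign_vector_iff)
    then show ?thesis using equal by simp
  next
    case greater
    then have "(1 - u) * h i p > 0" "u * h i q \<ge> 0"
      using assms that by (auto simp: face_le_sign_vector_iff)
    then show ?thesis using greater by (simp add: sgn_if)
  qed
  then show ?thesis
    unfolding sign_vector_def affine by auto
qed

lemma closed_cell: "closed {q. face_le (sv q) (sv p)}"
proof -
  have "closed {q. 0 \<le> h i q}" "closed {q. h i q \<le> 0}" for i
    using cont[of i] by (auto intro!: closed_Collect_le continuous_intros)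
  then have "closed {q. (0 \<le> h i p \<longrightarrow> 0 \<le> h i q) \<and> (h i p \<le> 0 \<longrightarrow> h i q \<le> 0)}" for i
    by (intro closed_Collect_conj closed_Collect_imp) auto
  then have "closed (\<Inter>i\<in>T. {q. (0 \<le> h i p \<longrightarrow> 0 \<le> h i q) \<and> (h i p \<le> 0 \<longrightarrow> h i q \<le> 0)})"
    by (intro closed_INT) auto
  moreover have "(\<Inter>i\<in>T. {q. (0 \<le> h i p \<longrightarrow> 0 \<le> h i q) \<and> (h i p \<le> 0 \<longrightarrow> h i q \<le> 0)}) = {q. face_le (sv q) (sv p)}"
    by (auto simp: face_le_sign_vector_iff)
  ultimately show ?thesis by simp
qed

lemma convex_cell: "convex {q. face_le (sv q) (sv p)}"
proof -
  have "0 \<le> h i ((1 - u) *\<^sub>R x + u *\<^sub>R y)" if "0 \<le> h i x" "0 \<le> h i y" "0 \<le> u" "u \<le> 1" for i u x y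
    unfolding affine using that by simp
  moreover have "h i ((1 - u) *\<^sub>R x + u *\<^sub>R y) \<le> 0" if "h i x \<le> 0" "h i y \<le> 0" "0 \<le> u" "u \<le> 1" for i u x y
    unfolding affine using that by (intro add_nonpos_nonpos mult_nonneg_nonpos) auto
  ultimately show ?thesis
    unfolding convex_alt face_le_sign_vector_iff by auto
qed

text \<open>The point $q$ is where the ray from $c$ through $p$ leaves the cell.\<close>

lemma cone_point_exists:
  assumes "p \<in> P" "sv p = sv c" "p \<noteq> c"
  shows "\<exists>u q. 0 \<le> u \<and> u < 1 \<and> face_le (sv q) (sv c) \<and> sv q \<noteq> sv c \<and> p = (1 - u) *\<^sub>R c + u *\<^sub>R q"
proof -
  define N where "N = {i \<in> T. h i c \<noteq> 0}"
  define \<rho> where "\<rho> = (\<lambda>i. h i p / h i c)"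
  have sgn: "sgn (h i p) = sgn (h i c)" if "i \<in> T" for i
    using fun_cong[OF assms(2), of i] that by (simp add: sign_vector_def)
  have hp: "h i p = \<rho> i * h i c" if "i \<in> T" for i
    using sgn[OF that] by (cases "h i c = 0") (auto simp: \<rho>_def sgn_eq_0_iff)
  have ray: "h i ((1 - s) *\<^sub>R c + s *\<^sub>R p) = (1 + s * (\<rho> i - 1)) * h i c" if "i \<in> T" for i s
    unfolding affine hp[OF that] by (simp add: algebra_simps)
  \<comment> \<open>Otherwise no nonzero h i would shrink along the ray, which would stay in the
    cell of c forever, against boundedness.\<close>
  have "\<exists>i\<in>N. \<rho> i < 1"
  proof (rule ccontr)
    assume "\<not> ?thesis"
    then have ge: "\<rho> i \<ge> 1" if "i \<in> N" for i
      using that by force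
    have inP: "(1 - s) *\<^sub>R c + s *\<^sub>R p \<in> P" if "s \<ge> 0" for s
    proof (rule down[OF assms(1)])
      have "sgn (h i ((1 - s) *\<^sub>R c + s *\<^sub>R p)) = sgn (h i c)" if "i \<in> T" for i
      proof (cases "h i c = 0")
        case False
        then have "0 \<le> s * (\<rho> i - 1)"
          using ge[of i] \<open>i \<in> T\<close> \<open>s \<ge> 0\<close> by (auto simp: N_def)
        then show ?thesis
          by (simp add: ray[OF that] sgn_mult)
      qed (simp add: ray[OF that])
      then have "sv ((1 - s) *\<^sub>R c + s *\<^sub>R p) = sv c"
        by (auto simp: sign_vector_def)
      then show "face_le (sv ((1 - s) *\<^sub>R c + s *\<^sub>R p)) (sv p)"
        by (simp add: assms(2))
    qed
    obtain B where B: "\<And>x. x \<in> P \<Longrightarrow> norm x \<le> B"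
      using bdd by (auto simp: bounded_iff)
    \<comment> \<open>At this parameter the distance from c is B + norm c + 1, while points of P are
      within B + norm c of c.\<close>
    define s where "s = (B + norm c + 1) / norm (p - c)"
    have "B \<ge> 0"
      using B[OF assms(1)] norm_ge_zero[of p] by linarith
    then have s: "s \<ge> 0" "s * norm (p - c) = B + norm c + 1"
      using assms(3) by (auto simp: s_def)
    have "s *\<^sub>R (p - c) = ((1 - s) *\<^sub>R c + s *\<^sub>R p) - c"
      by (simp add: algebra_simps)
    then have "norm (s *\<^sub>R (p - c)) \<le> B + norm c"
      using norm_triangle_ineq4[of "(1 - s) *\<^sub>R c + s *\<^sub>R p" c] B[OF inP[OF s(1)]] by simp
    then show False
      using s by simp
  qed
  then obtain i0 where i0: "i0 \<in> N" "\<rho> i0 < 1" by blast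
  define m where "m = Min (\<rho> ` N)"
  have fin: "finite (\<rho> ` N)" "\<rho> ` N \<noteq> {}"
    using finT i0 by (auto simp: N_def)
  have m: "m \<le> \<rho> i" if "i \<in> N" for i
    using fin that by (simp add: m_def)
  have "m \<in> \<rho> ` N"
    unfolding m_def by (rule Min_in[OF fin])
  then obtain j where j: "j \<in> N" "\<rho> j = m" by auto
  have m1: "m < 1"
    using m[OF i0(1)] i0(2) by simp
  have m0: "0 < m"
    using j sgn[of j] by (auto simp: N_def \<rho>_def zero_less_divide_iff sgn_if split: if_splits)
  \<comment> \<open>Here 1 + s (m - 1) = 0: the form with the least ratio m vanishes, and no other
    one has changed sign yet.\<close>
  define s where "s = 1 / (1 - m)"
  define q where "q = (1 - s) *\<^sub>R c + s *\<^sub>R p"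
  have hq: "h i q = ((\<rho> i - m) / (1 - m)) * h i c" if "i \<in> T" for i
    using m1 unfolding q_def ray[OF that] by (simp add: s_def field_simps)
  have "face_le (sv q) (sv c)"
    unfolding face_le_sign_vector_iff
  proof
    fix i assume "i \<in> T"
    show "(0 \<le> h i c \<longrightarrow> 0 \<le> h i q) \<and> (h i c \<le> 0 \<longrightarrow> h i q \<le> 0)"
    proof (cases "h i c = 0")
      case False
      then have "0 \<le> (\<rho> i - m) / (1 - m)"
        using m[of i] m1 \<open>i \<in> T\<close> by (simp add: N_def)
      then show ?thesis
        using hq[OF \<open>i \<in> T\<close>] by (metis mult_nonneg_nonneg mult_nonneg_nonpos)
    qed (simp add: hq[OF \<open>i \<in> T\<close>])
  qed
  moreover have "sv q \<noteq> sv c"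
  proof
    assume "sv q = sv c"
    then have "sgn (h j q) = sgn (h j c)"
      using fun_cong[of "sv q" "sv c" j] j(1) unfolding sign_vector_def N_def by simp
    then show False
      using j hq[of j] by (auto simp: N_def sgn_eq_0_iff)
  qed
  moreover have "p = (1 - (1 - m)) *\<^sub>R c + (1 - m) *\<^sub>R q"
  proof -
    have s: "(1 - m) * s = 1" "(1 - m) * (1 - s) = - m"
      using m1 by (simp_all add: s_def right_diff_distrib)
    show ?thesis
      unfolding q_def scaleR_add_right scaleR_scaleR s by simp
  qed
  ultimately show ?thesis
    using m0 m1 by (intro exI[of _ "1 - m"] exI[of _ q]) auto
qed

text \<open>If u \<le> u', then q' lies on the segment from c to q. Short of q all its points have
  the sign vector of c, so q' is q.\<close>

lemma cone_point_unique:
  assumes q: "face_le (sv q) (sv c)" "sv q \<noteq> sv c" and q': "face_le (sv q') (sv c)" "sv q' \<noteq> sv c"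
    and u: "0 \<le> u" "0 \<le> u'" and eq: "(1 - u) *\<^sub>R c + u *\<^sub>R q = (1 - u') *\<^sub>R c + u' *\<^sub>R q'"
  shows "u = u' \<and> (u = 0 \<or> q = q')"
proof -
  have *: "u = u' \<and> (u = 0 \<or> q = q')"
    if q: "face_le (sv q) (sv c)" and q': "sv q' \<noteq> sv c"
      and u: "0 \<le> u" "u \<le> u'" and eq: "(1 - u) *\<^sub>R c + u *\<^sub>R q = (1 - u') *\<^sub>R c + u' *\<^sub>R q'" for q q' u u'
  proof (cases "u' = 0")
    case True
    then show ?thesis using u by simp
  next
    case False
    define w where "w = u / u'"
    have w: "0 \<le> w" "w \<le> 1" "u' * w = u"
      using u False by (auto simp: w_def)
    have "u' *\<^sub>R q' = u' *\<^sub>R ((1 - w) *\<^sub>R c + w *\<^sub>R q)"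
      using eq w(3) by (simp add: algebra_simps)
    then have q'w: "q' = (1 - w) *\<^sub>R c + w *\<^sub>R q"
      using False by simp
    have "w = 1"
    proof (rule ccontr)
      assume "w \<noteq> 1"
      then show False
        using sv_combine[OF q, of w] w q'w q' by simp
    qed
    then show ?thesis
      using w q'w by simp
  qed
  show ?thesis
  proof (cases "u \<le> u'")
    case True
    then show ?thesis
      using *[OF q(1) q'(2) u(1) _ eq] by blast
  next
    case False
    then show ?thesis
      using *[OF q'(1) q(2) u(2) _ eq[symmetric]] by auto
  qed
qed

definition region :: "('i \<Rightarrow> real) set \<Rightarrow> 'a set" where
  "region D = {p \<in> P. sv p \<in> D}"

text \<open>Stated for a linear projection of G rather than for a map, so that it serves both
  coordinates of the graph. The cone points short of the base lie over the cell \<tau>, which the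
  image of G does not meet; \<open>cone_point_exists\<close> and \<open>cone_point_unique\<close>
  show that they cover that cell exactly once.\<close>

lemma cone_step:
  fixes \<pi> :: "'b::real_vector \<Rightarrow> 'a"
  assumes \<pi>: "linear \<pi>" and c: "\<pi> \<zeta> = c" "c \<in> P" "sv c = \<tau>" "\<tau> \<notin> D"
    and below: "\<And>q. face_le (sv q) \<tau> \<Longrightarrow> sv q \<noteq> \<tau> \<Longrightarrow> sv q \<in> D"
    and G: "inj_on \<pi> G" "\<pi> ` G = region D"
    and G': "G' = G \<union> {\<zeta>} \<union> {(1 - u) *\<^sub>R \<zeta> + u *\<^sub>R z | u z. 0 \<le> u \<and> u \<le> 1 \<and> z \<in> G \<and> face_le (sv (\<pi> z)) \<tau>}"
  shows "inj_on \<pi> G' \<and> \<pi> ` G' = region (insert \<tau> D)"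
proof -
  define B where "B = {z \<in> G. face_le (sv (\<pi> z)) \<tau>}"
  \<comment> \<open>Half-open, without the base of the cone, so that all of E lies over the new
    cell.\<close>
  define E where "E = {\<zeta>} \<union> {(1 - u) *\<^sub>R \<zeta> + u *\<^sub>R z | u z. 0 \<le> u \<and> u < 1 \<and> z \<in> B}"
  have G'E: "G' = G \<union> E"
  proof
    show "G' \<subseteq> G \<union> E"
    proof
      fix x assume "x \<in> G'"
      then consider "x \<in> G" | "x = \<zeta>" | u z where "x = (1 - u) *\<^sub>R \<zeta> + u *\<^sub>R z" "0 \<le> u" "u \<le> 1" "z \<in> B"
        unfolding G' B_def by blast
      then show "x \<in> G \<union> E"
      proof cases
        case 3
        then show ?thesis
          by (cases "u = 1") (auto simp: E_def B_def intro!: exI[of _ u])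
      qed (auto simp: E_def)
    qed
    show "G \<union> E \<subseteq> G'"
      unfolding G' E_def B_def by (auto intro: less_imp_le)
  qed
  have pi: "\<pi> ((1 - u) *\<^sub>R \<zeta> + u *\<^sub>R z) = (1 - u) *\<^sub>R c + u *\<^sub>R \<pi> z" for u z
    using \<pi> c(1) by (simp add: linear_add linear_scale)
  have B: "face_le (sv (\<pi> z)) \<tau>" "sv (\<pi> z) \<noteq> \<tau>" if "z \<in> B" for z
    using that G(2) c(4) by (auto simp: B_def region_def)
  have svE: "sv (\<pi> e) = \<tau>" if "e \<in> E" for e
    using that c B sv_combine unfolding E_def by (auto simp: pi)
  have svG: "\<pi> z \<in> P" "sv (\<pi> z) \<in> D" if "z \<in> G" for z
    using that G(2) by (auto simp: region_def)
  have injE: "inj_on \<pi> E"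
  proof (rule inj_onI)
    fix x y assume "x \<in> E" "y \<in> E" and eq: "\<pi> x = \<pi> y"
    have *: "x = \<zeta> \<or> (\<exists>u z. 0 \<le> u \<and> u < 1 \<and> z \<in> B \<and> x = (1 - u) *\<^sub>R \<zeta> + u *\<^sub>R z)"
      "y = \<zeta> \<or> (\<exists>u z. 0 \<le> u \<and> u < 1 \<and> z \<in> B \<and> y = (1 - u) *\<^sub>R \<zeta> + u *\<^sub>R z)"
      using \<open>x \<in> E\<close> \<open>y \<in> E\<close> by (auto simp: E_def)
    show "x = y"
    proof (cases "B = {}")
      case True
      then show ?thesis using * by auto
    next
      case False
      then obtain z0 where "z0 \<in> B" by blast
      \<comment> \<open>The apex is the cone point with parameter 0 over any base point, so it needs
        no case of its own.\<close>
      then have **: "\<exists>u z. 0 \<le> u \<and> u < 1 \<and> z \<in> B \<and> \<zeta> = (1 - u) *\<^sub>R \<zeta> + u *\<^sub>R z"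
        by (intro exI[of _ 0] exI[of _ z0]) auto
      obtain u z where u: "0 \<le> u" "u < 1" "z \<in> B" "x = (1 - u) *\<^sub>R \<zeta> + u *\<^sub>R z"
        using *(1) ** by blast
      obtain v w where v: "0 \<le> v" "v < 1" "w \<in> B" "y = (1 - v) *\<^sub>R \<zeta> + v *\<^sub>R w"
        using *(2) ** by blast
      have "u = v \<and> (u = 0 \<or> \<pi> z = \<pi> w)"
        using B[OF u(3)] B[OF v(3)] c(3) u v eq by (intro cone_point_unique) (auto simp: pi)
      moreover have "z \<in> G" "w \<in> G"
        using u v by (auto simp: B_def)
      ultimately show ?thesis
        using u v G(1) by (auto dest: inj_onD)
    qed
  qed
  have "inj_on \<pi> G'"
    unfolding G'E inj_on_Un using G(1) injE svE svG c(4) by fastforce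
  moreover have "\<pi> ` G' = region (insert \<tau> D)"
  proof
    show "\<pi> ` G' \<subseteq> region (insert \<tau> D)"
      unfolding G'E using svE svG down[OF c(2)] c(3) by (auto simp: region_def)
    show "region (insert \<tau> D) \<subseteq> \<pi> ` G'"
    proof
      fix p assume p: "p \<in> region (insert \<tau> D)"
      show "p \<in> \<pi> ` G'"
      proof (cases "sv p \<in> D")
        case True
        then have "p \<in> \<pi> ` G"
          using p unfolding G(2) by (simp add: region_def)
        then show ?thesis
          unfolding G'E by blast
      next
        case False
        then have p': "p \<in> P" "sv p = sv c"
          using p c(3) by (auto simp: region_def)
        show ?thesis
        proof (cases "p = c")
          case True
          then show ?thesis
            using c(1) by (auto simp: G')
        next
          case False
          then obtain u q where q: "0 \<le> u" "u < 1" "face_le (sv q) \<tau>" "sv q \<noteq> \<tau>" "p = (1 - u) *\<^sub>R c + u *\<^sub>R q"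
            using cone_point_exists[OF p'] c(3) by auto
          then have "q \<in> \<pi> ` G"
            unfolding G(2) using below down[OF c(2)] c(3) by (simp add: region_def)
          then obtain z where z: "z \<in> G" "q = \<pi> z" by blast
          then have "p = \<pi> ((1 - u) *\<^sub>R \<zeta> + u *\<^sub>R z)" "(1 - u) *\<^sub>R \<zeta> + u *\<^sub>R z \<in> G'"
            using q unfolding G' by (auto simp: pi intro!: exI[of _ u] exI[of _ z])
          then show ?thesis by blast
        qed
      qed
    qed
  qed
  ultimately show ?thesis by blast
qed

end

section \<open>Graphs built from cones\<close>

lemma compact_cone:
  fixes B :: "'b::real_normed_vector set"
  assumes "compact B"
  shows "compact {(1 - u) *\<^sub>R \<zeta> + u *\<^sub>R z | u z. 0 \<le> u \<and> u \<le> 1 \<and> z \<in> B}"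
proof -
  have "compact ((\<lambda>x. (1 - fst x) *\<^sub>R \<zeta> + fst x *\<^sub>R snd x) ` ({0..1::real} \<times> B))"
    using assms by (intro compact_continuous_image compact_Times continuous_intros) auto
  moreover have "(\<lambda>x. (1 - fst x) *\<^sub>R \<zeta> + fst x *\<^sub>R snd x) ` ({0..1::real} \<times> B) =
      {(1 - u) *\<^sub>R \<zeta> + u *\<^sub>R z | u z. 0 \<le> u \<and> u \<le> 1 \<and> z \<in> B}"
    by force
  ultimately show ?thesis by simp
qed

text \<open>
  The homeomorphism is constructed as its graph $G$: this is a finite union of iterated cones, hence
  compact, so injectivity of the two projections already gives continuity in both directions.
\<close>

lemma cells_graph:
  fixes h h' :: "'i \<Rightarrow> 'a::euclidean_space \<Rightarrow> real"
  assumes "cells T h P" "cells T h' P'"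
    and S: "sign_vector T h ` P = S" "sign_vector T h' ` P' = S"
    and c: "\<And>\<sigma>. \<sigma> \<in> S \<Longrightarrow> c \<sigma> \<in> P \<and> sign_vector T h (c \<sigma>) = \<sigma>"
    and c': "\<And>\<sigma>. \<sigma> \<in> S \<Longrightarrow> c' \<sigma> \<in> P' \<and> sign_vector T h' (c' \<sigma>) = \<sigma>"
    and D: "finite D" "D \<subseteq> S" "\<And>\<sigma> \<rho>. \<sigma> \<in> D \<Longrightarrow> \<rho> \<in> S \<Longrightarrow> face_le \<rho> \<sigma> \<Longrightarrow> \<rho> \<in> D"
  shows "\<exists>G. compact G \<and> (\<forall>z\<in>G. sign_vector T h (fst z) = sign_vector T h' (snd z)) \<and>
    inj_on fst G \<and> fst ` G = cells.region T h P D \<and>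
    inj_on snd G \<and> snd ` G = cells.region T h' P' D \<and>
    (\<forall>C\<subseteq>D. (\<forall>\<sigma>\<in>C. \<forall>\<tau>\<in>C. face_le \<sigma> \<tau> \<or> face_le \<tau> \<sigma>) \<longrightarrow> convex hull ((\<lambda>\<sigma>. (c \<sigma>, c' \<sigma>)) ` C) \<subseteq> G)"
proof -
  interpret X: cells T h P by fact
  interpret Y: cells T h' P' by fact
  define \<zeta> where "\<zeta> = (\<lambda>\<sigma>. (c \<sigma>, c' \<sigma>))"
  \<comment> \<open>The last clause keeps track of affinity: where the graph contains the convex
    hull of its chosen points over a chain of cells, the map is affine.\<close>
  define good where "good = (\<lambda>D G. compact G \<and> (\<forall>z\<in>G. X.sv (fst z) = Y.sv (snd z)) \<and>
    inj_on fst G \<and> fst ` G = X.region D \<and> inj_on snd G \<and> snd ` G = Y.region D \<and>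
    (\<forall>C\<subseteq>D. (\<forall>\<sigma>\<in>C. \<forall>\<tau>\<in>C. face_le \<sigma> \<tau> \<or> face_le \<tau> \<sigma>) \<longrightarrow> convex hull (\<zeta> ` C) \<subseteq> G))"
  have "\<exists>G. good D G"
    using D
  proof (induction "card D" arbitrary: D rule: less_induct)
    case less
    show ?case
    proof (cases "D = {}")
      case True
      then show ?thesis
        by (intro exI[of _ "{}"]) (auto simp: good_def X.region_def Y.region_def)
    next
      case False
      have "D \<subseteq> range X.sv"
        using less.prems(2) S(1) by blast
      then obtain \<tau> where \<tau>: "\<tau> \<in> D" "\<And>\<sigma>. \<sigma> \<in> D \<Longrightarrow> face_le \<tau> \<sigma> \<Longrightarrow> \<sigma> = \<tau>"
        using ex_face_le_maximal[OF less.prems(1) False X.finT] by blast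
      \<comment> \<open>Without a maximal cell the set stays closed under faces, and it still has
        all proper faces of \<tau>, so the graph over the boundary of the new cell is already
        there.\<close>
      define D0 where "D0 = D - {\<tau>}"
      have D: "D = insert \<tau> D0" "\<tau> \<notin> D0"
        using \<tau>(1) by (auto simp: D0_def)
      have "\<tau> \<in> S"
        using \<tau>(1) less.prems(2) by blast
      have IH: "card D0 < card D" "finite D0" "D0 \<subseteq> S"
        using less.prems(1,2) D by auto
      have down0: "\<rho> \<in> D0" if "\<sigma> \<in> D0" "\<rho> \<in> S" "face_le \<rho> \<sigma>" for \<sigma> \<rho>
        using less.prems(3)[of \<sigma> \<rho>] \<tau>(2)[of \<sigma>] that by (auto simp: D0_def)
      obtain G where "good D0 G"
        using less.hyps[OF IH] down0 by blast
      then have G: "compact G" "\<And>z. z \<in> G \<Longrightarrow> X.sv (fst z) = Y.sv (snd z)"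
        "inj_on fst G" "fst ` G = X.region D0" "inj_on snd G" "snd ` G = Y.region D0"
        and hull: "\<And>C. C \<subseteq> D0 \<Longrightarrow> \<forall>\<sigma>\<in>C. \<forall>\<tau>\<in>C. face_le \<sigma> \<tau> \<or> face_le \<tau> \<sigma> \<Longrightarrow> convex hull (\<zeta> ` C) \<subseteq> G"
        unfolding good_def by simp_all
      define G' where "G' = G \<union> {\<zeta> \<tau>} \<union> {(1 - u) *\<^sub>R \<zeta> \<tau> + u *\<^sub>R z | u z. 0 \<le> u \<and> u \<le> 1 \<and> z \<in> G \<and> face_le (X.sv (fst z)) \<tau>}"
      have G'Y: "G' = G \<union> {\<zeta> \<tau>} \<union> {(1 - u) *\<^sub>R \<zeta> \<tau> + u *\<^sub>R z | u z. 0 \<le> u \<and> u \<le> 1 \<and> z \<in> G \<and> face_le (Y.sv (snd z)) \<tau>}"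
        unfolding G'_def using G(2) by metis
      have belowX: "X.sv q \<in> D0" if "face_le (X.sv q) \<tau>" "X.sv q \<noteq> \<tau>" for q
      proof -
        have "q \<in> P"
          using X.down[of "c \<tau>" q] c[OF \<open>\<tau> \<in> S\<close>] that(1) by simp
        then show ?thesis
          using less.prems(3)[OF \<tau>(1), of "X.sv q"] that S(1) by (auto simp: D0_def)
      qed
      have belowY: "Y.sv q \<in> D0" if "face_le (Y.sv q) \<tau>" "Y.sv q \<noteq> \<tau>" for q
      proof -
        have "q \<in> P'"
          using Y.down[of "c' \<tau>" q] c'[OF \<open>\<tau> \<in> S\<close>] that(1) by simp
        then show ?thesis
          using less.prems(3)[OF \<tau>(1), of "Y.sv q"] that S(2) by (auto simp: D0_def)
      qed
      have "inj_on fst G' \<and> fst ` G' = X.region D"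
        unfolding D(1) using c[OF \<open>\<tau> \<in> S\<close>] D(2) belowX G(3,4)
        by (intro X.cone_step[OF linear_fst, of "\<zeta> \<tau>" "c \<tau>" \<tau> D0 G G']) (auto simp: \<zeta>_def G'_def)
      moreover have "inj_on snd G' \<and> snd ` G' = Y.region D"
        unfolding D(1) using c'[OF \<open>\<tau> \<in> S\<close>] D(2) belowY G(5,6)
        by (intro Y.cone_step[OF linear_snd, of "\<zeta> \<tau>" "c' \<tau>" \<tau> D0 G G']) (auto simp: \<zeta>_def G'Y)
      moreover have "compact G'"
      proof -
        let ?B = "{z \<in> G. face_le (X.sv (fst z)) \<tau>}"
        have "closed (fst -` {q. face_le (X.sv q) \<tau>} :: ('a \<times> 'a) set)"
          using X.closed_cell[of "c \<tau>"] c[OF \<open>\<tau> \<in> S\<close>]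
          by (intro closed_vimage continuous_on_fst continuous_on_id) auto
        then have "compact (G \<inter> fst -` {q. face_le (X.sv q) \<tau>})"
          using G(1) by (rule compact_Int_closed[rotated])
        moreover have "G \<inter> fst -` {q. face_le (X.sv q) \<tau>} = ?B" by auto
        ultimately have "compact {(1 - u) *\<^sub>R \<zeta> \<tau> + u *\<^sub>R z | u z. 0 \<le> u \<and> u \<le> 1 \<and> z \<in> ?B}"
          by (intro compact_cone) auto
        then have "compact {(1 - u) *\<^sub>R \<zeta> \<tau> + u *\<^sub>R z | u z. 0 \<le> u \<and> u \<le> 1 \<and> z \<in> G \<and> face_le (X.sv (fst z)) \<tau>}"
          by simp
        then show ?thesis
          unfolding G'_def using G(1) by (intro compact_Un) auto
      qed
      moreover have "X.sv (fst z) = Y.sv (snd z)" if zG: "z \<in> G'" for z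
      proof -
        consider "z \<in> G" | "z = \<zeta> \<tau>" | u w where "z = (1 - u) *\<^sub>R \<zeta> \<tau> + u *\<^sub>R w" "0 \<le> u" "u \<le> 1" "w \<in> G" "face_le (X.sv (fst w)) \<tau>"
          using zG unfolding G'_def by blast
        then show ?thesis
        proof cases
          case 1
          then show ?thesis using G(2) by blast
        next
          case 2
          then show ?thesis using c c' \<open>\<tau> \<in> S\<close> by (simp add: \<zeta>_def)
        next
          case 3
          show ?thesis
          proof (cases "u = 1")
            case True
            then show ?thesis using 3 G(2) by simp
          next
            case False
            then have "X.sv ((1 - u) *\<^sub>R c \<tau> + u *\<^sub>R fst w) = \<tau>" "Y.sv ((1 - u) *\<^sub>R c' \<tau> + u *\<^sub>R snd w) = \<tau>"
              using X.sv_combine[of "fst w" "c \<tau>" u] Y.sv_combine[of "snd w" "c' \<tau>" u] 3 G(2)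
                c[OF \<open>\<tau> \<in> S\<close>] c'[OF \<open>\<tau> \<in> S\<close>] by auto
            then show ?thesis
              using 3(1) by (simp add: \<zeta>_def)
          qed
        qed
      qed
      moreover have "convex hull (\<zeta> ` C) \<subseteq> G'"
        if C: "C \<subseteq> D" "\<forall>\<sigma>\<in>C. \<forall>\<tau>\<in>C. face_le \<sigma> \<tau> \<or> face_le \<tau> \<sigma>" for C
      proof (cases "\<tau> \<in> C")
        case False
        then have "C \<subseteq> D0"
          using C(1) D(1) by blast
        then show ?thesis
          using hull[OF _ C(2)] by (auto simp: G'_def)
      next
        case True
        \<comment> \<open>Being maximal, \<tau> is the top of the chain. The hull of the chain is
          therefore the cone with apex \<open>\<zeta> \<tau>\<close> over the hull of the rest,
          which lies over the closed cell of \<tau>.\<close>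
        define C0 where "C0 = C - {\<tau>}"
        have C0: "C = insert \<tau> C0" "C0 \<subseteq> D0"
          using True C(1) by (auto simp: C0_def D0_def)
        have sub: "convex hull (\<zeta> ` C0) \<subseteq> G"
          using C by (intro hull) (auto simp: C0)
        have le: "face_le (X.sv (fst z)) \<tau>" if "z \<in> convex hull (\<zeta> ` C0)" for z
        proof -
          have "face_le \<sigma> \<tau>" if "\<sigma> \<in> C0" for \<sigma>
            using C(2) \<tau>(2)[of \<sigma>] C0 that D by auto
          then have "c ` C0 \<subseteq> {q. face_le (X.sv q) \<tau>}"
            using c C0(2) IH(3) by auto
          then have "convex hull (c ` C0) \<subseteq> {q. face_le (X.sv q) \<tau>}"
            using X.convex_cell[of "c \<tau>"] c[OF \<open>\<tau> \<in> S\<close>] by (intro hull_minimal) auto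
          moreover have "fst ` (convex hull (\<zeta> ` C0)) = convex hull (c ` C0)"
            unfolding convex_hull_linear_image[OF linear_fst] by (simp add: image_image \<zeta>_def)
          ultimately show ?thesis
            using that by blast
        qed
        show ?thesis
        proof (cases "C0 = {}")
          case True
          then show ?thesis by (simp add: C0 G'_def)
        next
          case False
          show ?thesis
          proof
            fix x assume "x \<in> convex hull (\<zeta> ` C)"
            then obtain u v z where uv: "0 \<le> u" "0 \<le> v" "u + v = 1" and z: "z \<in> convex hull (\<zeta> ` C0)"
              and x: "x = u *\<^sub>R \<zeta> \<tau> + v *\<^sub>R z"
              using False unfolding C0(1) image_insert
              by (subst (asm) convex_hull_insert) (simp, blast)
            have "u = 1 - v" "v \<le> 1"
              using uv by auto
            then show "x \<in> G'"
              unfolding G'_def using x z sub le[OF z] \<open>0 \<le> v\<close> by blast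
          qed
        qed
      qed
      ultimately have "good D G'"
        unfolding good_def by simp
      then show ?thesis by blast
    qed
  qed
  then show ?thesis
    unfolding good_def \<zeta>_def .
qed

text \<open>Both projections of the compact graph are continuous bijections, hence homeomorphisms,
  and F is the second after the inverse of the first. The chosen points c and c' belong to the
  conclusion because the hulls on which F is affine are spanned by them.\<close>

lemma cells_homeomorphism:
  fixes h h' :: "'i \<Rightarrow> 'a::euclidean_space \<Rightarrow> real"
  assumes X: "cells T h P" and Y: "cells T h' P'"
    and S: "sign_vector T h ` P = sign_vector T h' ` P'"
  obtains F F' c c' where "homeomorphism P P' F F'"
    "\<And>p. p \<in> P \<Longrightarrow> sign_vector T h' (F p) = sign_vector T h p"
    "\<And>p. p \<in> P \<Longrightarrow> c (sign_vector T h p) \<in> P \<and> sign_vector T h (c (sign_vector T h p)) = sign_vector T h p"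
    "\<And>p. p \<in> P \<Longrightarrow> c' (sign_vector T h p) \<in> P' \<and> sign_vector T h' (c' (sign_vector T h p)) = sign_vector T h p"
    "\<And>C z. C \<subseteq> sign_vector T h ` P \<Longrightarrow> \<forall>\<sigma>\<in>C. \<forall>\<tau>\<in>C. face_le \<sigma> \<tau> \<or> face_le \<tau> \<sigma> \<Longrightarrow>
        z \<in> convex hull ((\<lambda>\<sigma>. (c \<sigma>, c' \<sigma>)) ` C) \<Longrightarrow> fst z \<in> P \<and> F (fst z) = snd z"
proof -
  define S where "S = sign_vector T h ` P"
  define c where "c = inv_into P (sign_vector T h)"
  define c' where "c' = inv_into P' (sign_vector T h')"
  have c: "c \<sigma> \<in> P \<and> sign_vector T h (c \<sigma>) = \<sigma>" if "\<sigma> \<in> S" for \<sigma>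
    using that unfolding S_def c_def by (auto simp: inv_into_into f_inv_into_f)
  have c': "c' \<sigma> \<in> P' \<and> sign_vector T h' (c' \<sigma>) = \<sigma>" if "\<sigma> \<in> S" for \<sigma>
    using that unfolding S_def S c'_def by (auto simp: inv_into_into f_inv_into_f)
  have "finite T"
    using X by (simp add: cells_def)
  have sgn_cases: "sgn x = -1 \<or> sgn x = 0 \<or> sgn x = 1" for x :: real
    by (simp add: sgn_if)
  have "S \<subseteq> {f. \<forall>i. (i \<in> T \<longrightarrow> f i \<in> {-1, 0, 1}) \<and> (i \<notin> T \<longrightarrow> f i = 0)}"
    by (auto simp: S_def sign_vector_def) (metis sgn_cases)
  then have "finite S"
    by (rule finite_subset) (intro finite_set_of_finite_funs \<open>finite T\<close>, simp)
  have SS: "sign_vector T h ` P = S" "sign_vector T h' ` P' = S"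
    using S by (auto simp: S_def)
  have "\<exists>G. compact G \<and> (\<forall>z\<in>G. sign_vector T h (fst z) = sign_vector T h' (snd z)) \<and>
    inj_on fst G \<and> fst ` G = cells.region T h P S \<and>
    inj_on snd G \<and> snd ` G = cells.region T h' P' S \<and>
    (\<forall>C\<subseteq>S. (\<forall>\<sigma>\<in>C. \<forall>\<tau>\<in>C. face_le \<sigma> \<tau> \<or> face_le \<tau> \<sigma>) \<longrightarrow> convex hull ((\<lambda>\<sigma>. (c \<sigma>, c' \<sigma>)) ` C) \<subseteq> G)"
    (is "\<exists>G. ?good G")
    by (rule cells_graph[OF X Y SS c c' \<open>finite S\<close> subset_refl])
  then obtain G where "?good G" ..
  then have G: "compact G" "\<And>z. z \<in> G \<Longrightarrow> sign_vector T h (fst z) = sign_vector T h' (snd z)"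
    "inj_on fst G" "fst ` G = cells.region T h P S" "inj_on snd G" "snd ` G = cells.region T h' P' S"
    and hull: "\<And>C. C \<subseteq> S \<Longrightarrow> \<forall>\<sigma>\<in>C. \<forall>\<tau>\<in>C. face_le \<sigma> \<tau> \<or> face_le \<tau> \<sigma> \<Longrightarrow> convex hull ((\<lambda>\<sigma>. (c \<sigma>, c' \<sigma>)) ` C) \<subseteq> G"
    by simp_all
  have img: "fst ` G = P" "snd ` G = P'"
    using G(4,6) S by (auto simp: cells.region_def[OF X] cells.region_def[OF Y] S_def)
  obtain f where f: "homeomorphism G P fst f"
    using homeomorphism_compact[OF G(1) _ img(1) G(3)] continuous_on_fst continuous_on_id by blast
  obtain g where g: "homeomorphism G P' snd g"
    using homeomorphism_compact[OF G(1) _ img(2) G(5)] continuous_on_snd continuous_on_id by blast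
  have F: "homeomorphism P P' (snd \<circ> f) (fst \<circ> g)"
    using homeomorphism_compose[OF homeomorphism_symD[OF f] g] .
  show thesis
  proof (rule that[OF F])
    fix p assume "p \<in> P"
    then have "f p \<in> G" "fst (f p) = p"
      using f by (auto simp: homeomorphism_def)
    then show "sign_vector T h' ((snd \<circ> f) p) = sign_vector T h p"
      using G(2)[of "f p"] by simp
  next
    fix C z assume "C \<subseteq> sign_vector T h ` P" "\<forall>\<sigma>\<in>C. \<forall>\<tau>\<in>C. face_le \<sigma> \<tau> \<or> face_le \<tau> \<sigma>"
      "z \<in> convex hull ((\<lambda>\<sigma>. (c \<sigma>, c' \<sigma>)) ` C)"
    then have "z \<in> G"
      using hull[of C] by (auto simp: S_def)
    then show "fst z \<in> P \<and> (snd \<circ> f) (fst z) = snd z"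
      using f img by (auto simp: homeomorphism_def)
  qed (use c c' in \<open>auto simp: S_def\<close>)
qed

subsection \<open>Radial extension\<close>

lemma continuous_on_Max_image:
  fixes f :: "'i \<Rightarrow> 'a::topological_space \<Rightarrow> real"
  assumes "finite I" "I \<noteq> {}" "\<And>i. i \<in> I \<Longrightarrow> continuous_on S (f i)"
  shows "continuous_on S (\<lambda>x. Max ((\<lambda>i. f i x) ` I))"
  using assms
proof (induction I rule: finite_ne_induct)
  case (insert i I)
  then have "continuous_on S (\<lambda>x. max (f i x) (Max ((\<lambda>i. f i x) ` I)))"
    by (intro continuous_on_max) auto
  moreover have "Max ((\<lambda>i. f i x) ` insert i I) = max (f i x) (Max ((\<lambda>i. f i x) ` I))" for x
    using insert.hyps by (simp add: Max_insert)
  ultimately show ?case by simp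
qed auto

text \<open>a + (p - a) / g p is the point with g = 1 on the ray from a through p; its image is
  moved away from a' by the factor g p.\<close>

definition radial_ext :: "('a::real_vector \<Rightarrow> real) \<Rightarrow> 'a \<Rightarrow> 'a \<Rightarrow> ('a \<Rightarrow> 'a) \<Rightarrow> 'a \<Rightarrow> 'a" where
  "radial_ext g a a' F p =
     (if g p \<le> 1 then F p else a' + g p *\<^sub>R (F (a + (1 / g p) *\<^sub>R (p - a)) - a'))"

lemma continuous_on_radial_ext:
  fixes g :: "'a::real_normed_vector \<Rightarrow> real"
  assumes contg: "continuous_on UNIV g"
    and hom: "\<And>s p. 0 < s \<Longrightarrow> g (a + s *\<^sub>R (p - a)) = s * g p"
    and F: "continuous_on {p. g p \<le> 1} F"
  shows "continuous_on UNIV (radial_ext g a a' F)"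
proof -
  have "continuous_on {p \<in> UNIV. 1 \<le> g p} (\<lambda>p. F (a + (1 / g p) *\<^sub>R (p - a)))"
    by (intro continuous_on_compose2[OF F] continuous_intros continuous_on_subset[OF contg]) (auto simp: hom)
  then have "continuous_on {p \<in> UNIV. 1 \<le> g p} (\<lambda>p. a' + g p *\<^sub>R (F (a + (1 / g p) *\<^sub>R (p - a)) - a'))"
    by (intro continuous_intros continuous_on_subset[OF contg]) auto
  then show ?thesis
    unfolding radial_ext_def using F contg by (intro continuous_on_cases_le) auto
qed

text \<open>Outside, the image has gauge g p again because F maps boundary to boundary, so the
  inverse finds the same boundary point and the same factor.\<close>

lemma radial_ext_inverse:
  fixes g :: "'a::real_vector \<Rightarrow> real"
  assumes hom: "\<And>s p. 0 < s \<Longrightarrow> g (a + s *\<^sub>R (p - a)) = s * g p"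
    and hom': "\<And>s p. 0 < s \<Longrightarrow> g' (a' + s *\<^sub>R (p - a')) = s * g' p"
    and F: "\<And>p. g p \<le> 1 \<Longrightarrow> g' (F p) \<le> 1" "\<And>p. g p \<le> 1 \<Longrightarrow> F' (F p) = p"
    and boundary: "\<And>p. g p = 1 \<Longrightarrow> g' (F p) = 1"
  shows "radial_ext g' a' a F' (radial_ext g a a' F p) = p"
proof (cases "g p \<le> 1")
  case True
  then show ?thesis
    using F by (simp add: radial_ext_def)
next
  case False
  define q where "q = a + (1 / g p) *\<^sub>R (p - a)"
  have q: "g q = 1" "p = a + g p *\<^sub>R (q - a)"
    using False by (auto simp: q_def hom)
  have E: "radial_ext g a a' F p = a' + g p *\<^sub>R (F q - a')"
    using False by (simp add: radial_ext_def q_def)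
  have "g' (a' + g p *\<^sub>R (F q - a')) = g p"
    using False boundary[OF q(1)] by (simp add: hom')
  then have "radial_ext g' a' a F' (a' + g p *\<^sub>R (F q - a')) = a + g p *\<^sub>R (q - a)"
    using False F(2)[of q] q(1) by (simp add: radial_ext_def)
  then show ?thesis
    using E q(2) by simp
qed

lemma homeomorphism_radial_ext:
  fixes g :: "'a::real_normed_vector \<Rightarrow> real"
  assumes g: "continuous_on UNIV g" "\<And>s p. 0 < s \<Longrightarrow> g (a + s *\<^sub>R (p - a)) = s * g p"
    and g': "continuous_on UNIV g'" "\<And>s p. 0 < s \<Longrightarrow> g' (a' + s *\<^sub>R (p - a')) = s * g' p"
    and F: "homeomorphism {p. g p \<le> 1} {p. g' p \<le> 1} F F'"
    and boundary: "\<And>p. g p \<le> 1 \<Longrightarrow> g' (F p) = 1 \<longleftrightarrow> g p = 1"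
  shows "homeomorphism UNIV UNIV (radial_ext g a a' F) (radial_ext g' a' a F')"
proof -
  have F1: "\<And>p. g p \<le> 1 \<Longrightarrow> g' (F p) \<le> 1" "\<And>p. g p \<le> 1 \<Longrightarrow> F' (F p) = p"
    "\<And>p. g' p \<le> 1 \<Longrightarrow> g (F' p) \<le> 1" "\<And>p. g' p \<le> 1 \<Longrightarrow> F (F' p) = p"
    "continuous_on {p. g p \<le> 1} F" "continuous_on {p. g' p \<le> 1} F'"
    using F unfolding homeomorphism_def by blast+
  have "g (F' p) = 1" if "g' p = 1" for p
    using boundary[of "F' p"] F1(3,4)[of p] that by auto
  then have "radial_ext g a a' F (radial_ext g' a' a F' p) = p" for p
    using F1 by (intro radial_ext_inverse g(2) g'(2)) auto
  moreover have "radial_ext g' a' a F' (radial_ext g a a' F p) = p" for p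
    using F1 boundary by (intro radial_ext_inverse g(2) g'(2)) auto
  ultimately show ?thesis
    using continuous_on_radial_ext[OF g F1(5), of a'] continuous_on_radial_ext[OF g' F1(6), of a]
    by (intro homeomorphismI) auto
qed

text \<open>Each term is the affine function with value 0 at a and 1 on the i-th plane. For a
  bounded polyhedron the maximum is its Minkowski gauge with centre a.\<close>

definition plane_gauge :: "'i set \<Rightarrow> ('i \<Rightarrow> 'a \<Rightarrow> real) \<Rightarrow> 'a \<Rightarrow> 'a \<Rightarrow> real" where
  "plane_gauge I h a p = Max ((\<lambda>i. 1 - h i p / h i a) ` I)"

context
  fixes I :: "'i set" and h :: "'i \<Rightarrow> 'a::real_normed_vector \<Rightarrow> real" and a :: 'a
  assumes fin: "finite I" "I \<noteq> {}" and pos: "\<And>i. i \<in> I \<Longrightarrow> 0 < h i a"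
begin

lemma quotient_iff:
  assumes "i \<in> I"
  shows "0 \<le> h i p / h i a \<longleftrightarrow> 0 \<le> h i p" "h i p / h i a = 0 \<longleftrightarrow> h i p = 0"
  using pos[OF assms] by (auto simp: zero_le_divide_iff)

lemma plane_gauge_le_1_iff: "plane_gauge I h a p \<le> 1 \<longleftrightarrow> (\<forall>i\<in>I. 0 \<le> h i p)"
proof -
  have "plane_gauge I h a p \<le> 1 \<longleftrightarrow> (\<forall>i\<in>I. 0 \<le> h i p / h i a)"
    unfolding plane_gauge_def using fin by (subst Max_le_iff) auto
  then show ?thesis
    using quotient_iff(1) by simp
qed

lemma plane_gauge_eq_1_iff: "plane_gauge I h a p = 1 \<longleftrightarrow> (\<forall>i\<in>I. 0 \<le> h i p) \<and> (\<exists>i\<in>I. h i p = 0)"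
proof -
  have "plane_gauge I h a p = 1 \<longleftrightarrow> 1 \<in> (\<lambda>i. 1 - h i p / h i a) ` I \<and> (\<forall>y\<in>(\<lambda>i. 1 - h i p / h i a) ` I. y \<le> 1)"
    unfolding plane_gauge_def using fin by (intro Max_eq_iff) auto
  also have "\<dots> \<longleftrightarrow> (\<forall>i\<in>I. 0 \<le> h i p / h i a) \<and> (\<exists>i\<in>I. h i p / h i a = 0)"
    by (auto simp: image_iff simp del: divide_eq_0_iff)
  also have "\<dots> \<longleftrightarrow> (\<forall>i\<in>I. 0 \<le> h i p) \<and> (\<exists>i\<in>I. h i p = 0)"
    using quotient_iff by simp
  finally show ?thesis .
qed

lemma continuous_on_plane_gauge:
  assumes "\<And>i. i \<in> I \<Longrightarrow> continuous_on UNIV (h i)"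
  shows "continuous_on UNIV (plane_gauge I h a)"
  unfolding plane_gauge_def[abs_def]
proof (intro continuous_on_Max_image fin)
  fix i assume "i \<in> I"
  then have "h i a \<noteq> 0"
    using pos by force
  then show "continuous_on UNIV (\<lambda>p. 1 - h i p / h i a)"
    using assms[OF \<open>i \<in> I\<close>] by (intro continuous_intros) auto
qed

lemma plane_gauge_homogeneous:
  assumes affine: "\<And>i u p q. h i ((1 - u) *\<^sub>R p + u *\<^sub>R q) = (1 - u) * h i p + u * h i q" and "0 < s"
  shows "plane_gauge I h a (a + s *\<^sub>R (p - a)) = s * plane_gauge I h a p"
proof -
  have "1 - h i (a + s *\<^sub>R (p - a)) / h i a = s * (1 - h i p / h i a)" if "i \<in> I" for i
  proof -
    have "a + s *\<^sub>R (p - a) = (1 - s) *\<^sub>R a + s *\<^sub>R p"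
      by (simp add: algebra_simps)
    then have e: "h i (a + s *\<^sub>R (p - a)) = (1 - s) * h i a + s * h i p"
      by (simp only: affine)
    show ?thesis
      unfolding e using pos[OF that] by (simp add: field_simps)
  qed
  then have "(\<lambda>i. 1 - h i (a + s *\<^sub>R (p - a)) / h i a) ` I = (*) s ` (\<lambda>i. 1 - h i p / h i a) ` I"
    by (simp add: image_image)
  moreover have "mono ((*) s)"
    using assms(2) by (simp add: mono_def)
  ultimately show ?thesis
    unfolding plane_gauge_def using mono_Max_commute[of "(*) s" "(\<lambda>i. 1 - h i p / h i a) ` I"] fin by simp
qed

end

subsection \<open>Homogeneous coordinates\<close>

lemma det4_linear:
  "det4 (x + y) b c d = det4 x b c d + det4 y b c d" "det4 (k *\<^sub>R x) b c d = k * det4 x b c d"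
  "det4 a (x + y) c d = det4 a x c d + det4 a y c d" "det4 a (k *\<^sub>R x) c d = k * det4 a x c d"
  "det4 a b (x + y) d = det4 a b x d + det4 a b y d" "det4 a b (k *\<^sub>R x) d = k * det4 a b x d"
  "det4 a b c (x + y) = det4 a b c x + det4 a b c y" "det4 a b c (k *\<^sub>R x) = k * det4 a b c x"
  by (simp_all add: det4_expand algebra_simps)

lemma homogenize_nth [simp]:
  "homogenize p $ 1 = 1" "homogenize p $ 2 = p $ 1" "homogenize p $ 3 = p $ 2" "homogenize p $ 4 = p $ 3"
  by (simp_all add: homogenize_def)

lemma homogenize_affine:
  "homogenize ((1 - u) *\<^sub>R p + u *\<^sub>R q) = (1 - u) *\<^sub>R homogenize p + u *\<^sub>R homogenize q"
  by (simp add: vec_eq_iff forall_4)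

lemma inner_homogenize: "z \<bullet> homogenize p = z $ 1 + vector [z $ 2, z $ 3, z $ 4] \<bullet> p"
  by (simp add: inner_vec_def sum_4 sum_3)

lemma homogenize_surj:
  assumes "y $ 1 = 1"
  obtains p where "homogenize p = y"
proof
  show "homogenize (vector [y $ 2, y $ 3, y $ 4]) = y"
    using assms by (simp add: vec_eq_iff forall_4)
qed

lemma homogenize_inj: "homogenize p = homogenize q \<Longrightarrow> p = q"
  by (simp add: vec_eq_iff forall_4 forall_3)

lemma continuous_on_inner_homogenize: "continuous_on S (\<lambda>p. z \<bullet> homogenize p)"
  unfolding inner_homogenize by (intro continuous_intros)

lemma det4_homogenize:
  "det4 (homogenize p) (homogenize q) (homogenize r) (homogenize s) = det (vector [q - p, r - p, s - p] :: real^3^3)"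
  by (simp add: det4_expand det_3 algebra_simps)

text \<open>A nonzero z orthogonal to the four vectors is the equation of a plane; its linear part
  is not 0, since otherwise the constant term would be 0 as well.\<close>

lemma ex_hyperplane_if_det4_homogenize_eq_0:
  assumes "det4 (homogenize p) (homogenize q) (homogenize r) (homogenize s) = 0"
  shows "\<exists>a b. a \<noteq> 0 \<and> {p, q, r, s} \<subseteq> {x. a \<bullet> x = b}"
proof -
  obtain z where z: "z \<noteq> 0" "homogenize p \<bullet> z = 0" "homogenize q \<bullet> z = 0" "homogenize r \<bullet> z = 0" "homogenize s \<bullet> z = 0"
    using assms det4_nz_iff by blast
  define a :: "real^3" where "a = vector [z $ 2, z $ 3, z $ 4]"
  have 0: "z $ 1 + a \<bullet> x = 0" if "x \<in> {p, q, r, s}" for x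
    using that z inner_homogenize[of z x] by (auto simp: a_def inner_commute)
  have "a \<noteq> 0"
  proof
    assume "a = 0"
    then have "z $ 1 = 0"
      using 0[of p] by simp
    moreover have "z $ 2 = 0" "z $ 3 = 0" "z $ 4 = 0"
      using \<open>a = 0\<close> by (auto simp: a_def vec_eq_iff forall_3)
    ultimately show False
      using z(1) by (simp add: vec_eq_iff forall_4)
  qed
  then show ?thesis
    using 0 by (intro exI[of _ a] exI[of _ "- z $ 1"]) (auto simp: eq_neg_iff_add_eq_0 add.commute)
qed

lemma det4_homogenize_eq_0_if_hyperplane:
  assumes "a \<noteq> 0" "{p, q, r, s} \<subseteq> {x. a \<bullet> x = b}"
  shows "det4 (homogenize p) (homogenize q) (homogenize r) (homogenize s) = 0"
proof -
  define z :: "real^4" where "z = vector [- b, a $ 1, a $ 2, a $ 3]"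
  have a: "vector [z $ 2, z $ 3, z $ 4] = a" and b: "z $ 1 = - b"
    by (simp_all add: z_def vec_eq_iff forall_3)
  have "homogenize x \<bullet> z = 0" if "x \<in> {p, q, r, s}" for x
    using that assms(2) unfolding inner_commute[of _ z] inner_homogenize a b by auto
  moreover have "z \<noteq> 0"
    using assms(1) by (auto simp: z_def vec_eq_iff forall_3 forall_4)
  ultimately show ?thesis
    using det4_nz_iff by blast
qed

text \<open>An affinely independent subset with the same affine hull has at most three
  points.\<close>

lemma coplanar_if_hyperplane:
  fixes S :: "(real^3) set"
  assumes "a \<noteq> 0" "S \<subseteq> {x. a \<bullet> x = b}"
  shows "coplanar S"
proof -
  obtain B where B: "B \<subseteq> S" "\<not> affine_dependent B" "affine hull S = affine hull B"
    using affine_basis_exists by blast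
  have "aff_dim B \<le> aff_dim {x. a \<bullet> x = b}"
    using B(1) assms(2) by (intro aff_dim_subset) auto
  then have "aff_dim B \<le> 2"
    using assms(1) by simp
  then have "card B \<le> 3"
    using aff_dim_affine_independent[OF B(2)] by linarith
  then have "coplanar B"
    using aff_independent_finite[OF B(2)] by (intro coplanar_small)
  then show ?thesis
    using B(3) by (metis coplanar_affine_hull_coplanar)
qed

text \<open>With the edge vectors as columns of M and M', A is M' M^-1, and det A has the sign of
  det M det M'.\<close>

lemma ex_affine_map:
  fixes p0 p1 p2 p3 q0 q1 q2 q3 :: "real^3"
  assumes "0 < det (vector [p1 - p0, p2 - p0, p3 - p0] :: real^3^3) * det (vector [q1 - q0, q2 - q0, q3 - q0] :: real^3^3)"
  shows "\<exists>A :: real^3^3. 0 < det A \<and> A *v (p1 - p0) = q1 - q0 \<and> A *v (p2 - p0) = q2 - q0 \<and> A *v (p3 - p0) = q3 - q0"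
proof -
  let ?R = "vector [p1 - p0, p2 - p0, p3 - p0] :: real^3^3" and ?R' = "vector [q1 - q0, q2 - q0, q3 - q0] :: real^3^3"
  define M where "M = transpose ?R"
  define M' where "M' = transpose ?R'"
  have det: "0 < det M * det M'" "det M \<noteq> 0"
    using assms by (auto simp: M_def M'_def)
  define A where "A = M' ** matrix_inv M"
  have AM: "A ** M = M'"
    unfolding A_def matrix_mul_assoc[symmetric] matrix_inv_if_det_nz(2)[OF det(2)] by simp
  then have "det A * det M = det M'"
    by (metis det_mul)
  then have "0 < det A * (det M * det M)"
    using det(1) by (metis mult.assoc mult.commute)
  then have "0 < det A"
    using det(2) by (simp add: zero_less_mult_iff)
  moreover have "A *v (?R $ k) = ?R' $ k" for k
  proof -
    have "M *v axis k 1 = ?R $ k" "M' *v axis k 1 = ?R' $ k"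
      by (simp_all add: M_def M'_def matrix_vector_mult_basis column_def transpose_def vec_eq_iff)
    then show ?thesis
      using AM by (metis matrix_vector_mul_assoc)
  qed
  from this[of 1] this[of 2] this[of 3]
  have "A *v (p1 - p0) = q1 - q0" "A *v (p2 - p0) = q2 - q0" "A *v (p3 - p0) = q3 - q0"
    by simp_all
  ultimately show ?thesis by blast
qed

text \<open>By Cramer's rule the determinants with y in last place are, up to sign and the factor
  \<open>det4 a0 a1 a2 a3\<close>, the coefficients of y at a3, a2, a1. The hypotheses make y0 = a0
  and the coefficient matrix of y0, ..., y3 triangular with positive diagonal.\<close>

lemma sgn_det4_flag:
  assumes nz: "det4 a0 a1 a2 a3 \<noteq> 0" and y0: "a0 $ 1 = 1" "y0 $ 1 = 1"
    "det4 a0 a1 a2 y0 = 0" "det4 a0 a1 a3 y0 = 0" "det4 a0 a2 a3 y0 = 0"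
    and y1: "det4 a0 a1 a2 y1 = 0" "det4 a0 a1 a3 y1 = 0" "sgn (det4 a0 a2 a3 y1) = sgn (det4 a0 a2 a3 a1)"
    and y2: "det4 a0 a1 a2 y2 = 0" "sgn (det4 a0 a1 a3 y2) = sgn (det4 a0 a1 a3 a2)"
    and y3: "sgn (det4 a0 a1 a2 y3) = sgn (det4 a0 a1 a2 a3)"
  shows "sgn (det4 y0 y1 y2 y3) = sgn (det4 a0 a1 a2 a3)"
proof -
  have perm: "det4 a0 a1 a3 a2 = - det4 a0 a1 a2 a3" "det4 a0 a2 a3 a1 = det4 a0 a1 a2 a3"
    by (simp_all add: det4_expand algebra_simps)
  have coeff: "det4 a0 a1 a2 y = s * det4 a0 a1 a2 a3" "det4 a0 a1 a3 y = - r * det4 a0 a1 a2 a3"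
    "det4 a0 a2 a3 y = q * det4 a0 a1 a2 a3"
    if "y = p *\<^sub>R a0 + q *\<^sub>R a1 + r *\<^sub>R a2 + s *\<^sub>R a3" for y p q r s
    using that perm by (simp_all add: det4_linear)
  obtain p q r s where 0: "y0 = p *\<^sub>R a0 + q *\<^sub>R a1 + r *\<^sub>R a2 + s *\<^sub>R a3"
    using det4_basis[OF nz, of y0] by blast
  have "y0 = p *\<^sub>R a0"
    using 0 coeff[OF 0] y0(3-5) nz by simp
  moreover from this have "p = 1"
    using y0(1,2) by simp
  ultimately have e0: "y0 = a0" by simp
  obtain p1 q1 r1 s1 where 1: "y1 = p1 *\<^sub>R a0 + q1 *\<^sub>R a1 + r1 *\<^sub>R a2 + s1 *\<^sub>R a3"
    using det4_basis[OF nz, of y1] by blast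
  have e1: "y1 = p1 *\<^sub>R a0 + q1 *\<^sub>R a1" "sgn q1 = 1"
    using 1 coeff[OF 1] y1 nz perm by (auto simp: sgn_mult sgn_eq_0_iff)
  obtain p2 q2 r2 s2 where 2: "y2 = p2 *\<^sub>R a0 + q2 *\<^sub>R a1 + r2 *\<^sub>R a2 + s2 *\<^sub>R a3"
    using det4_basis[OF nz, of y2] by blast
  have e2: "y2 = p2 *\<^sub>R a0 + q2 *\<^sub>R a1 + r2 *\<^sub>R a2" "sgn r2 = 1"
    using 2 coeff[OF 2] y2 nz perm by (auto simp: sgn_mult sgn_eq_0_iff)
  obtain p3 q3 r3 s3 where 3: "y3 = p3 *\<^sub>R a0 + q3 *\<^sub>R a1 + r3 *\<^sub>R a2 + s3 *\<^sub>R a3"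
    using det4_basis[OF nz, of y3] by blast
  have e3: "sgn s3 = 1"
    using 3 coeff[OF 3] y3 nz by (auto simp: sgn_mult sgn_eq_0_iff)
  have "det4 y0 y1 y2 y3 = q1 * r2 * s3 * det4 a0 a1 a2 a3"
    unfolding e0 e1(1) e2(1) 3 by (simp add: det4_linear)
  then show ?thesis
    using e1 e2 e3 by (simp add: sgn_mult)
qed

section \<open>Planes through triples of points\<close>

definition triple_cross :: "(nat \<Rightarrow> real^3) \<Rightarrow> idx3 \<Rightarrow> real^4" where
  "triple_cross x = (\<lambda>(i, j, k). cross4 (homogenize (x i)) (homogenize (x j)) (homogenize (x k)))"

definition triples :: "nat \<Rightarrow> idx3 set" where
  "triples n = {..<n} \<times> {..<n} \<times> {..<n}"

definition plane_fun :: "(nat \<Rightarrow> real^3) \<Rightarrow> idx3 \<Rightarrow> real^3 \<Rightarrow> real" where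
  "plane_fun x I p = triple_cross x I \<bullet> homogenize p"

lemma plane_fun_eq: "plane_fun x (i, j, k) p = det4 (homogenize (x i)) (homogenize (x j)) (homogenize (x k)) (homogenize p)"
  by (simp add: plane_fun_def triple_cross_def inner_cross4)

lemma plane_fun_affine:
  "plane_fun x I ((1 - u) *\<^sub>R p + u *\<^sub>R q) = (1 - u) * plane_fun x I p + u * plane_fun x I q"
  by (simp add: plane_fun_def homogenize_affine inner_add_right)

lemma finite_triples [simp]: "finite (triples n)"
  by (simp add: triples_def)

lemma triple_normal_triple_cross: "\<exists>r>0. triple_normal (homogenize \<circ> x) I = r *\<^sub>R triple_cross x I"
  by (cases I) (auto simp: triple_normal_def triple_cross_def unit_normal_cross4)

lemma SGeom_isomorphic_sgn:
  assumes "SGeom_isomorphic n (SGeom_Aff x) (SGeom_Aff x')"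
  shows "\<And>i j k l. i < n \<Longrightarrow> j < n \<Longrightarrow> k < n \<Longrightarrow> l < n \<Longrightarrow> sgn (plane_fun x (i, j, k) (x l)) = sgn (plane_fun x' (i, j, k) (x' l))"
    and "\<And>I J K L. I \<in> triples n \<Longrightarrow> J \<in> triples n \<Longrightarrow> K \<in> triples n \<Longrightarrow> L \<in> triples n \<Longrightarrow>
      sgn (det4 (triple_cross x I) (triple_cross x J) (triple_cross x K) (triple_cross x L)) =
      sgn (det4 (triple_cross x' I) (triple_cross x' J) (triple_cross x' K) (triple_cross x' L))"
proof -
  fix i j k l assume "i < n" "j < n" "k < n" "l < n"
  then have "(i, j, k, l) \<in> {..<n} \<times> {..<n} \<times> {..<n} \<times> {..<n}" by simp
  then have "affine_chirotope x (i, j, k, l) = affine_chirotope x' (i, j, k, l)"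
    using assms unfolding SGeom_isomorphic_def SGeom_Aff_def Let_def fst_conv by blast
  then show "sgn (plane_fun x (i, j, k) (x l)) = sgn (plane_fun x' (i, j, k) (x' l))"
    by (simp add: affine_chirotope_def sign_det_def plane_fun_eq)
next
  fix I J K L assume IJKL: "I \<in> triples n" "J \<in> triples n" "K \<in> triples n" "L \<in> triples n"
  then have "(I, J, K, L) \<in> triples n \<times> triples n \<times> triples n \<times> triples n" by simp
  then have "wedge_chirotope (homogenize \<circ> x) (I, J, K, L) = wedge_chirotope (homogenize \<circ> x') (I, J, K, L)"
    using assms unfolding SGeom_isomorphic_def SGeom_Aff_def Let_def snd_conv triples_def by blast
  moreover have "wedge_chirotope (homogenize \<circ> x) (I, J, K, L) =
      sgn (det4 (triple_cross x I) (triple_cross x J) (triple_cross x K) (triple_cross x L))" for x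
  proof -
    obtain r s t u where "r > 0" "s > 0" "t > 0" "u > 0" "triple_normal (homogenize \<circ> x) I = r *\<^sub>R triple_cross x I"
      "triple_normal (homogenize \<circ> x) J = s *\<^sub>R triple_cross x J" "triple_normal (homogenize \<circ> x) K = t *\<^sub>R triple_cross x K"
      "triple_normal (homogenize \<circ> x) L = u *\<^sub>R triple_cross x L"
      using triple_normal_triple_cross by metis
    then show ?thesis
      by (simp add: wedge_chirotope_def sign_det_def det4_scaleR sgn_mult)
  qed
  ultimately show "sgn (det4 (triple_cross x I) (triple_cross x J) (triple_cross x K) (triple_cross x L)) =
      sgn (det4 (triple_cross x' I) (triple_cross x' J) (triple_cross x' K) (triple_cross x' L))"
    by simp
qed

subsection \<open>The plane arrangement of a point configuration\<close>

text \<open>Four points in general position make the vectors \<open>homogenize (x i)\<close>, and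
  then their normals, span R^4.\<close>

locale generic_points =
  fixes n :: nat and x :: "nat \<Rightarrow> real^3"
  assumes n4: "4 \<le> n"
    and generic: "\<And>i j k l. i < n \<Longrightarrow> j < n \<Longrightarrow> k < n \<Longrightarrow> l < n \<Longrightarrow> distinct [i, j, k, l] \<Longrightarrow>
      det4 (homogenize (x i)) (homogenize (x j)) (homogenize (x k)) (homogenize (x l)) \<noteq> 0"
begin

text \<open>Facets of the hull as oriented triples. The strict inequality removes triples with a
  repeated index, for which \<open>plane_fun\<close> is identically 0.\<close>

definition facets :: "idx3 set" where
  "facets = {I \<in> triples n. (\<forall>l<n. 0 \<le> plane_fun x I (x l)) \<and> (\<exists>l<n. 0 < plane_fun x I (x l))}"

text \<open>The convex hull of the points, given by inequalities so that membership depends only on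
  signs.\<close>

definition body :: "(real^3) set" where
  "body = {p. \<forall>I\<in>facets. 0 \<le> plane_fun x I p}"

abbreviation "hx i \<equiv> homogenize (x i)"

lemma base_nz: "det4 (hx 0) (hx 1) (hx 2) (hx 3) \<noteq> 0"
  using n4 by (intro generic) auto

lemma span_points: "span (hx ` {..<n}) = UNIV"
proof -
  have "hx 0 \<in> hx ` {..<n}" "hx 1 \<in> hx ` {..<n}" "hx 2 \<in> hx ` {..<n}" "hx 3 \<in> hx ` {..<n}"
    using n4 by auto
  then show ?thesis
    using base_nz unfolding det4_nz_iff span_eq_UNIV_iff_orthogonal by metis
qed

lemma span_triple_cross: "span (triple_cross x ` triples n) = UNIV"
  unfolding span_eq_UNIV_iff_orthogonal
proof (intro allI impI)
  fix y assume "\<forall>v\<in>triple_cross x ` triples n. v \<bullet> y = 0"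
  then have 0: "det4 (hx i) (hx j) (hx k) y = 0" if "i < n" "j < n" "k < n" for i j k
    using that by (auto simp: triples_def triple_cross_def inner_cross4)
  obtain p q r s where y: "y = p *\<^sub>R hx 0 + q *\<^sub>R hx 1 + r *\<^sub>R hx 2 + s *\<^sub>R hx 3"
    using det4_basis[OF base_nz] by blast
  have "p * det4 (hx 1) (hx 2) (hx 3) (hx 0) = 0" "q * det4 (hx 0) (hx 2) (hx 3) (hx 1) = 0"
    "r * det4 (hx 0) (hx 1) (hx 3) (hx 2) = 0" "s * det4 (hx 0) (hx 1) (hx 2) (hx 3) = 0"
    using 0[of 1 2 3] 0[of 0 2 3] 0[of 0 1 3] 0[of 0 1 2] n4 unfolding y by (simp_all add: det4_linear)
  moreover have "det4 (hx 1) (hx 2) (hx 3) (hx 0) \<noteq> 0" "det4 (hx 0) (hx 2) (hx 3) (hx 1) \<noteq> 0"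
    "det4 (hx 0) (hx 1) (hx 3) (hx 2) \<noteq> 0" "det4 (hx 0) (hx 1) (hx 2) (hx 3) \<noteq> 0"
    using n4 by (intro generic; simp)+
  ultimately show "y = 0"
    unfolding y by simp
qed

text \<open>This replaces the description of the convex hull of the points by its facets.\<close>

lemma facet_cone_dual:
  assumes y: "\<And>I. I \<in> facets \<Longrightarrow> 0 \<le> triple_cross x I \<bullet> y"
    and f: "\<And>l. l < n \<Longrightarrow> 0 \<le> f \<bullet> hx l"
  shows "0 \<le> f \<bullet> y"
proof -
  have cross: "0 \<le> cross4 (hx i) (hx j) (hx k) \<bullet> y"
    if ijk: "i < n" "j < n" "k < n" and nonneg: "\<And>l. l < n \<Longrightarrow> 0 \<le> cross4 (hx i) (hx j) (hx k) \<bullet> hx l" for i j k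
  proof (cases "\<exists>l<n. 0 < cross4 (hx i) (hx j) (hx k) \<bullet> hx l")
    case True
    then have "(i, j, k) \<in> facets"
      using ijk nonneg by (auto simp: facets_def triples_def plane_fun_def triple_cross_def)
    then show ?thesis
      using y[of "(i, j, k)"] by (simp add: triple_cross_def)
  next
    case False
    then have "v \<bullet> cross4 (hx i) (hx j) (hx k) = 0" if "v \<in> hx ` {..<n}" for v
      using nonneg that by (auto simp: inner_commute) (metis inner_commute less_eq_real_def)
    then have "cross4 (hx i) (hx j) (hx k) = 0"
      using span_points unfolding span_eq_UNIV_iff_orthogonal by blast
    then show ?thesis by simp
  qed
  have "(\<forall>l<n. 0 \<le> f \<bullet> hx l) \<longrightarrow> 0 \<le> f \<bullet> y"
  proof (rule cocircuit_induct[of "hx ` {..<n}" "\<lambda>f. (\<forall>l<n. 0 \<le> f \<bullet> hx l) \<longrightarrow> 0 \<le> f \<bullet> y"])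
    fix t a b c assume "a \<in> hx ` {..<n}" "b \<in> hx ` {..<n}" "c \<in> hx ` {..<n}"
    then obtain i j k where ijk: "i < n" "j < n" "k < n" "a = hx i" "b = hx j" "c = hx k" by auto
    show "(\<forall>l<n. 0 \<le> (t *\<^sub>R cross4 a b c) \<bullet> hx l) \<longrightarrow> 0 \<le> (t *\<^sub>R cross4 a b c) \<bullet> y"
    proof
      assume *: "\<forall>l<n. 0 \<le> (t *\<^sub>R cross4 a b c) \<bullet> hx l"
      show "0 \<le> (t *\<^sub>R cross4 a b c) \<bullet> y"
      proof (cases t "0::real" rule: linorder_cases)
        case greater
        then show ?thesis
          using cross[OF ijk(1-3)] * by (simp add: ijk zero_le_mult_iff)
      next
        \<comment> \<open>A negative multiple is a positive multiple for the triple with its first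
          two indices exchanged.\<close>
        case less
        then show ?thesis
          using cross[OF ijk(2,1,3)] * by (simp add: ijk zero_le_mult_iff cross4_swap[of "hx j" "hx i"])
      qed simp
    qed
  next
    fix r s
    assume r: "(\<forall>l<n. 0 \<le> r \<bullet> hx l) \<longrightarrow> 0 \<le> r \<bullet> y" and s: "(\<forall>l<n. 0 \<le> s \<bullet> hx l) \<longrightarrow> 0 \<le> s \<bullet> y"
      and conf: "\<And>v. v \<in> hx ` {..<n} \<Longrightarrow> 0 \<le> (v \<bullet> r) * (v \<bullet> s)"
    show "(\<forall>l<n. 0 \<le> (r + s) \<bullet> hx l) \<longrightarrow> 0 \<le> (r + s) \<bullet> y"
    proof
      assume sum: "\<forall>l<n. 0 \<le> (r + s) \<bullet> hx l"
      \<comment> \<open>r and s never have opposite signs at a point, so a nonnegative sum forces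
        both to be nonnegative.\<close>
      have "0 \<le> r \<bullet> hx l \<and> 0 \<le> s \<bullet> hx l" if "l < n" for l
      proof -
        have "0 \<le> (r \<bullet> hx l) * (s \<bullet> hx l)"
          using conf[of "hx l"] that by (simp add: inner_commute)
        moreover have "0 \<le> r \<bullet> hx l + s \<bullet> hx l"
          using sum that by (simp add: inner_add_left)
        ultimately show ?thesis
          by (auto simp: zero_le_mult_iff)
      qed
      then show "0 \<le> (r + s) \<bullet> y"
        using r s by (simp add: inner_add_left)
    qed
  qed (use span_points in auto)
  then show ?thesis
    using f by blast
qed

text \<open>M bounds all coordinates of the homogenized points, so the forms M e1 + e_j and M e1 -
  e_j are nonnegative at them, and by \<open>facet_cone_dual\<close> on the whole facet
  cone.\<close>

lemma facet_cone_bound: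
  "\<exists>M>0. \<forall>y. (\<forall>I\<in>facets. 0 \<le> triple_cross x I \<bullet> y) \<longrightarrow> (\<forall>j. \<bar>y $ j\<bar> \<le> M * y $ 1)"
proof -
  define M where "M = (\<Sum>l<n. norm (hx l)) + 1"
  have M: "\<bar>hx l $ j\<bar> \<le> M" if "l < n" for l j
  proof -
    have "\<bar>hx l $ j\<bar> \<le> norm (hx l)"
      by (rule component_le_norm_cart)
    also have "\<dots> \<le> (\<Sum>l<n. norm (hx l))"
      using that by (intro member_le_sum) auto
    finally show ?thesis by (simp add: M_def)
  qed
  have "\<bar>y $ j\<bar> \<le> M * y $ 1" if y: "\<forall>I\<in>facets. 0 \<le> triple_cross x I \<bullet> y" for y j
  proof -
    have inner: "(M *\<^sub>R axis 1 1 + s *\<^sub>R axis j 1) \<bullet> v = M * v $ 1 + s * v $ j" for s and v :: "real^4"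
      by (simp add: inner_add_left inner_axis')
    have "0 \<le> (M *\<^sub>R axis 1 1 + s *\<^sub>R axis j 1) \<bullet> y" if s: "s = 1 \<or> s = -1" for s
    proof (rule facet_cone_dual)
      fix l assume "l < n"
      then show "0 \<le> (M *\<^sub>R axis 1 1 + s *\<^sub>R axis j 1) \<bullet> hx l"
        unfolding inner using M[of l j] s by auto
    qed (use y in blast)
    from this[of 1] this[of "-1"] show ?thesis
      unfolding inner by auto
  qed
  moreover have "M > 0"
    unfolding M_def by (intro add_nonneg_pos sum_nonneg) auto
  ultimately show ?thesis by blast
qed

text \<open>By the bound, some nonzero coordinate forces a positive first one. So every nonzero
  vector of the facet cone can be scaled to a point of R^3.\<close>

lemma facet_cone_pos:
  assumes "\<And>I. I \<in> facets \<Longrightarrow> 0 \<le> triple_cross x I \<bullet> y" "y \<noteq> 0"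
  shows "0 < y $ 1"
proof -
  obtain M where M: "M > 0" "\<And>j. \<bar>y $ j\<bar> \<le> M * y $ 1"
    using facet_cone_bound assms(1) by blast
  obtain j where "y $ j \<noteq> 0"
    using assms(2) by (auto simp: vec_eq_iff)
  then have "0 < M * y $ 1"
    using M(2)[of j] by linarith
  then show ?thesis
    using M(1) by (simp add: zero_less_mult_iff)
qed

lemma bounded_body: "bounded body"
proof -
  obtain M where M: "M > 0" "\<And>y j. (\<forall>I\<in>facets. 0 \<le> triple_cross x I \<bullet> y) \<Longrightarrow> \<bar>y $ j\<bar> \<le> M * y $ 1"
    using facet_cone_bound by blast
  have "\<bar>p $ j\<bar> \<le> M" if "p \<in> body" for p j
  proof -
    have *: "\<bar>homogenize p $ j\<bar> \<le> M" for j
      using M(2)[of "homogenize p" j] that by (simp add: body_def plane_fun_def)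
    show ?thesis
      using *[of 2] *[of 3] *[of 4] exhaust_3[of j] by auto
  qed
  then have "norm p \<le> (\<Sum>j\<in>(UNIV :: 3 set). M)" if "p \<in> body" for p
    using that by (intro order_trans[OF norm_le_l1_cart] sum_mono) auto
  then show ?thesis
    unfolding bounded_iff by blast
qed

lemma point_in_body: "i < n \<Longrightarrow> x i \<in> body"
  by (simp add: body_def facets_def)

lemma convex_body: "convex body"
proof -
  have "0 \<le> plane_fun x I ((1 - u) *\<^sub>R p + u *\<^sub>R q)"
    if "0 \<le> plane_fun x I p" "0 \<le> plane_fun x I q" "0 \<le> u" "u \<le> 1" for I u p q
    unfolding plane_fun_affine using that by simp
  then show ?thesis
    unfolding convex_alt body_def by auto
qed

text \<open>The centroid works, since each facet has some point strictly on its positive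
  side.\<close>

lemma ex_center: "\<exists>a. \<forall>I\<in>facets. 0 < plane_fun x I a"
proof -
  define y where "y = (1 / real n) *\<^sub>R (\<Sum>l<n. hx l)"
  have "y $ 1 = 1"
    using n4 by (simp add: y_def)
  then obtain a where a: "homogenize a = y"
    by (rule homogenize_surj)
  have "0 < plane_fun x I a" if "I \<in> facets" for I
  proof -
    have "plane_fun x I a = (1 / real n) * (\<Sum>l<n. plane_fun x I (x l))"
      by (simp add: plane_fun_def a y_def inner_sum_right)
    moreover have "0 < (\<Sum>l<n. plane_fun x I (x l))"
      using that by (auto simp: facets_def intro: sum_pos2)
    ultimately show ?thesis
      using n4 by simp
  qed
  then show ?thesis by blast
qed

text \<open>Without facets the body would be the whole space.\<close>

lemma facets_nonempty: "facets \<noteq> {}"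
  using bounded_body not_bounded_UNIV unfolding body_def by auto

lemma finite_facets: "finite facets"
  by (rule finite_subset[of _ "triples n"]) (auto simp: facets_def)

sublocale cells "triples n" "plane_fun x" body
proof
  fix p q assume p: "p \<in> body" and le: "face_le (sign_vector (triples n) (plane_fun x) q) (sign_vector (triples n) (plane_fun x) p)"
  have "0 \<le> plane_fun x I q" if "I \<in> facets" for I
  proof -
    have "I \<in> triples n" "0 \<le> plane_fun x I p"
      using that p unfolding body_def facets_def by blast+
    then show ?thesis
      using le[unfolded face_le_sign_vector_iff] by blast
  qed
  then show "q \<in> body"
    by (simp add: body_def)
qed (auto simp: plane_fun_def[abs_def] bounded_body homogenize_affine inner_add_right intro: continuous_on_inner_homogenize)

end

text \<open>By continuity a small step from p changes none of the finitely many nonzero signs; only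
  zeros may become nonzero.\<close>

lemma (in cells) ex_face_le_step: "\<exists>u. 0 < u \<and> u < 1 \<and> face_le (sv p) (sv ((1 - u) *\<^sub>R p + u *\<^sub>R q))"
proof -
  have "\<forall>\<^sub>F u in at_right 0. h i p = 0 \<or> sgn ((1 - u) * h i p + u * h i q) = sgn (h i p)" for i
  proof -
    have "((\<lambda>u. (1 - u) * h i p + u * h i q) \<longlongrightarrow> (1 - 0) * h i p + 0 * h i q) (at_right 0)"
      by (intro tendsto_intros)
    then have lim: "((\<lambda>u. (1 - u) * h i p + u * h i q) \<longlongrightarrow> h i p) (at_right 0)"
      by simp
    show ?thesis
    proof (cases "h i p" "0 :: real" rule: linorder_cases)
      case less
      from order_tendstoD(2)[OF lim less] show ?thesis
        by eventually_elim (use less in simp)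
    next
      case greater
      from order_tendstoD(1)[OF lim greater] show ?thesis
        by eventually_elim (use greater in simp)
    qed simp
  qed
  then have "\<forall>\<^sub>F u in at_right 0. \<forall>i\<in>T. h i p = 0 \<or> sgn ((1 - u) * h i p + u * h i q) = sgn (h i p)"
    by (intro eventually_ball_finite finT) auto
  moreover have "\<forall>\<^sub>F u in at_right (0::real). u \<in> {0<..<1}"
    by (rule eventually_at_right_real) simp
  ultimately have "\<forall>\<^sub>F u in at_right 0. u \<in> {0<..<1} \<and> (\<forall>i\<in>T. h i p = 0 \<or> sgn ((1 - u) * h i p + u * h i q) = sgn (h i p))"
    by eventually_elim auto
  then obtain u where u: "u \<in> {0<..<1}" "\<forall>i\<in>T. h i p = 0 \<or> sgn ((1 - u) * h i p + u * h i q) = sgn (h i p)"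
    using eventually_happens' trivial_limit_at_right_real by blast
  then show ?thesis
    by (intro exI[of _ u]) (auto simp: face_le_def sign_vector_def affine)
qed

section \<open>Comparison of two configurations\<close>

lemma facets_eq:
  assumes "generic_points n x" "generic_points n x'"
    and iso: "SGeom_isomorphic n (SGeom_Aff x) (SGeom_Aff x')"
  shows "generic_points.facets n x = generic_points.facets n x'"
proof -
  interpret X: generic_points n x by fact
  interpret Y: generic_points n x' by fact
  show ?thesis
    unfolding X.facets_def Y.facets_def
  proof (intro Collect_cong conj_cong refl)
    fix I assume I: "I \<in> triples n"
    have *: "sgn (plane_fun x I (x l)) = sgn (plane_fun x' I (x' l))" if "l < n" for l
      using SGeom_isomorphic_sgn(1)[OF iso, of "fst I" "fst (snd I)" "snd (snd I)" l] I that by (auto simp: triples_def)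
    then have "0 \<le> plane_fun x I (x l) \<longleftrightarrow> 0 \<le> plane_fun x' I (x' l)"
      "0 < plane_fun x I (x l) \<longleftrightarrow> 0 < plane_fun x' I (x' l)" if "l < n" for l
      using that by (metis sgn_less not_less, metis sgn_greater)
    then show "(\<forall>l<n. 0 \<le> plane_fun x I (x l)) = (\<forall>l<n. 0 \<le> plane_fun x' I (x' l))"
      "(\<exists>l<n. 0 < plane_fun x I (x l)) = (\<exists>l<n. 0 < plane_fun x' I (x' l))"
      by auto
  qed
qed

lemma same_sign_vectors:
  assumes "generic_points n x" "generic_points n x'"
    and iso: "SGeom_isomorphic n (SGeom_Aff x) (SGeom_Aff x')"
    and p: "p \<in> generic_points.body n x"
  shows "\<exists>p'\<in>generic_points.body n x'. sign_vector (triples n) (plane_fun x') p' = sign_vector (triples n) (plane_fun x) p"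
proof -
  interpret X: generic_points n x by fact
  interpret Y: generic_points n x' by fact
  obtain y where y: "\<And>I. I \<in> triples n \<Longrightarrow> sgn (triple_cross x' I \<bullet> y) = sgn (plane_fun x I p)"
    using same_covectors[OF finite_triples X.span_triple_cross SGeom_isomorphic_sgn(2)[OF iso], of "homogenize p"]
    unfolding plane_fun_def by blast
  have facets: "X.facets = Y.facets"
    by (rule facets_eq[OF assms(1-3)])
  have nonneg: "0 \<le> triple_cross x' I \<bullet> y" if "I \<in> Y.facets" for I
  proof -
    have I: "I \<in> X.facets"
      using that facets by simp
    then have "0 \<le> plane_fun x I p"
      using p unfolding X.body_def by blast
    moreover have "I \<in> triples n"
      using I unfolding X.facets_def by blast
    ultimately show ?thesis
      using y[of I] by (metis not_less sgn_less)
  qed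
  \<comment> \<open>Otherwise \<open>homogenize p\<close> would be orthogonal to all the normals,
    which span R^4.\<close>
  have "y \<noteq> 0"
  proof
    assume "y = 0"
    then have "triple_cross x I \<bullet> homogenize p = 0" if "I \<in> triples n" for I
      using y[OF that] by (simp add: plane_fun_def sgn_eq_0_iff)
    then have "homogenize p = 0"
      using X.span_triple_cross unfolding span_eq_UNIV_iff_orthogonal by blast
    then have "homogenize p $ 1 = 0" by simp
    then show False by simp
  qed
  then have pos: "0 < y $ 1"
    using Y.facet_cone_pos nonneg by blast
  then have "((1 / y $ 1) *\<^sub>R y) $ 1 = 1" by simp
  then obtain p' where p': "homogenize p' = (1 / y $ 1) *\<^sub>R y"
    by (rule homogenize_surj)
  have pf: "plane_fun x' I p' = (1 / y $ 1) * (triple_cross x' I \<bullet> y)" for I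
    by (simp add: plane_fun_def p')
  have "p' \<in> Y.body"
    using nonneg pos by (simp add: Y.body_def pf)
  moreover have "sign_vector (triples n) (plane_fun x') p' = sign_vector (triples n) (plane_fun x) p"
    using y pos by (auto simp: sign_vector_def pf sgn_mult)
  ultimately show ?thesis by blast
qed

text \<open>A segment between two of the points is cut out by signs. In the basis given by i, j and
  two further points k, l, the planes i j k and i j l put p' on the line, and the planes j k l and i
  k l give its coefficients the signs of 1 - t and t.\<close>

lemma segment_sign_vector:
  assumes "generic_points n x" "generic_points n x'"
    and iso: "SGeom_isomorphic n (SGeom_Aff x) (SGeom_Aff x')"
    and ij: "i < n" "j < n" "i \<noteq> j"
    and p: "p \<in> closed_segment (x i) (x j)"
    and sv: "sign_vector (triples n) (plane_fun x') p' = sign_vector (triples n) (plane_fun x) p"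
  shows "p' \<in> closed_segment (x' i) (x' j)"
proof -
  interpret X: generic_points n x by fact
  interpret Y: generic_points n x' by fact
  obtain t where t: "0 \<le> t" "t \<le> 1" "p = (1 - t) *\<^sub>R x i + t *\<^sub>R x j"
    using p by (auto simp: in_segment)
  have ex: "\<exists>k<n. k \<notin> {a, b, c}" for a b c
  proof (rule ccontr)
    assume "\<not> ?thesis"
    then have "card {..<n} \<le> card {a, b, c}"
      by (intro card_mono) auto
    also have "\<dots> \<le> 3"
      using card_length[of "[a, b, c]"] by simp
    finally show False
      using X.n4 by simp
  qed
  obtain k where "k < n" "k \<notin> {i, j}"
    using ex[of i j j] by auto
  moreover obtain l where "l < n" "l \<notin> {i, j, k}"
    using ex[of i j k] by auto
  ultimately have kl: "k < n" "l < n" "k \<noteq> l" "k \<notin> {i, j}" "l \<notin> {i, j}"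
    by auto
  have hp: "homogenize p = (1 - t) *\<^sub>R X.hx i + t *\<^sub>R X.hx j"
    unfolding t(3) by (rule homogenize_affine)
  have sgn: "sgn (plane_fun x' (a, b, c) p') = sgn (plane_fun x (a, b, c) p)" if "a < n" "b < n" "c < n" for a b c
    using fun_cong[OF sv, of "(a, b, c)"] that by (simp add: sign_vector_def triples_def)
  have nz: "det4 (Y.hx i) (Y.hx j) (Y.hx k) (Y.hx l) \<noteq> 0" "det4 (Y.hx i) (Y.hx j) (Y.hx l) (Y.hx k) \<noteq> 0"
    "det4 (Y.hx j) (Y.hx k) (Y.hx l) (Y.hx i) \<noteq> 0" "det4 (Y.hx i) (Y.hx k) (Y.hx l) (Y.hx j) \<noteq> 0"
    using ij kl by (intro Y.generic; auto)+
  obtain \<alpha> \<beta> \<gamma> \<delta> where hp': "homogenize p' = \<alpha> *\<^sub>R Y.hx i + \<beta> *\<^sub>R Y.hx j + \<gamma> *\<^sub>R Y.hx k + \<delta> *\<^sub>R Y.hx l"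
    using det4_basis[OF nz(1)] by blast
  have "\<delta> = 0"
    using sgn[of i j k] ij kl nz by (simp add: plane_fun_eq hp hp' det4_linear sgn_eq_0_iff)
  moreover have "\<gamma> = 0"
    using sgn[of i j l] ij kl nz by (simp add: plane_fun_eq hp hp' det4_linear sgn_eq_0_iff)
  moreover have "sgn \<alpha> = sgn (1 - t)"
    using sgn[of j k l] SGeom_isomorphic_sgn(1)[OF iso, of j k l i] ij kl nz
    by (simp add: plane_fun_eq hp hp' det4_linear sgn_mult sgn_eq_0_iff)
  moreover have "sgn \<beta> = sgn t"
    using sgn[of i k l] SGeom_isomorphic_sgn(1)[OF iso, of i k l j] ij kl nz
    by (simp add: plane_fun_eq hp hp' det4_linear sgn_mult sgn_eq_0_iff)
  ultimately have \<alpha>\<beta>: "homogenize p' = \<alpha> *\<^sub>R Y.hx i + \<beta> *\<^sub>R Y.hx j" "0 \<le> \<alpha>" "0 \<le> \<beta>"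
    using t hp' by (simp, metis diff_ge_0_iff_ge not_less sgn_less, metis not_less sgn_less)
  have "\<alpha> + \<beta> = 1"
    using arg_cong[OF \<alpha>\<beta>(1), of "\<lambda>v. v $ 1"] by simp
  then have "\<alpha> = 1 - \<beta>" by simp
  then have "homogenize p' = homogenize ((1 - \<beta>) *\<^sub>R x' i + \<beta> *\<^sub>R x' j)"
    using \<alpha>\<beta>(1) by (simp add: homogenize_affine)
  then have "p' = (1 - \<beta>) *\<^sub>R x' i + \<beta> *\<^sub>R x' j"
    by (rule homogenize_inj)
  then show ?thesis
    using \<alpha>\<beta> \<open>\<alpha> = 1 - \<beta>\<close> by (auto simp: in_segment)
qed

lemma SGeom_isomorphic_sym: "SGeom_isomorphic n G G' \<Longrightarrow> SGeom_isomorphic n G' G"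
  by (simp add: SGeom_isomorphic_def Let_def)

subsection \<open>The isotopy\<close>

lemma generic_points_if_general_position:
  assumes "4 \<le> n" "general_position n x"
  shows "generic_points n x"
proof
  fix i j k l assume "i < n" "j < n" "k < n" "l < n" "distinct [i, j, k, l]"
  then have "\<not> coplanar {x i, x j, x k, x l}"
    using assms(2) unfolding general_position_def by blast
  then show "det4 (homogenize (x i)) (homogenize (x j)) (homogenize (x k)) (homogenize (x l)) \<noteq> 0"
    using ex_hyperplane_if_det4_homogenize_eq_0 coplanar_if_hyperplane by blast
qed (fact assms(1))

context generic_points
begin

text \<open>These signs force the orientation of the simplex to be that of the first four points.\<close>

definition flag :: "real^3 \<Rightarrow> real^3 \<Rightarrow> real^3 \<Rightarrow> real^3 \<Rightarrow> bool" where
  "flag p0 p1 p2 p3 \<longleftrightarrow>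
     sgn (plane_fun x (0, 1, 2) p0) = 0 \<and> sgn (plane_fun x (0, 1, 3) p0) = 0 \<and> sgn (plane_fun x (0, 2, 3) p0) = 0 \<and>
     sgn (plane_fun x (0, 1, 2) p1) = 0 \<and> sgn (plane_fun x (0, 1, 3) p1) = 0 \<and>
     sgn (plane_fun x (0, 2, 3) p1) = sgn (plane_fun x (0, 2, 3) (x 1)) \<and>
     sgn (plane_fun x (0, 1, 2) p2) = 0 \<and> sgn (plane_fun x (0, 1, 3) p2) = sgn (plane_fun x (0, 1, 3) (x 2)) \<and>
     sgn (plane_fun x (0, 1, 2) p3) = sgn (plane_fun x (0, 1, 2) (x 3))"

lemma sgn_det4_if_flag:
  assumes "flag p0 p1 p2 p3"
  shows "sgn (det4 (homogenize p0) (homogenize p1) (homogenize p2) (homogenize p3)) = sgn (plane_fun x (0, 1, 2) (x 3))"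
  unfolding plane_fun_eq
  by (rule sgn_det4_flag)
    (use assms[unfolded flag_def plane_fun_eq sgn_eq_0_iff] base_nz in \<open>simp_all only: homogenize_nth not_False_eq_True\<close>)

text \<open>Start at x 0 and take small steps towards x 1, x 2, x 3. Each step goes up in the face
  order, stays in the hull by convexity, and turns a plane function from 0 into a positive multiple
  of its value at the target.\<close>

lemma ex_flag:
  "\<exists>p0 p1 p2 p3. {p0, p1, p2, p3} \<subseteq> body \<and> flag p0 p1 p2 p3 \<and>
     face_le (sv p0) (sv p1) \<and> face_le (sv p1) (sv p2) \<and> face_le (sv p2) (sv p3)"
proof -
  have in_body: "(1 - u) *\<^sub>R p + u *\<^sub>R x k \<in> body" if "p \<in> body" "0 < u" "u < 1" "k < 4" for u p k
    using convexD_alt[OF convex_body that(1) point_in_body[of k]] that n4 by simp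
  obtain u1 where u1: "0 < u1" "u1 < 1" "face_le (sv (x 0)) (sv ((1 - u1) *\<^sub>R x 0 + u1 *\<^sub>R x 1))"
    using ex_face_le_step by blast
  define p1 where "p1 = (1 - u1) *\<^sub>R x 0 + u1 *\<^sub>R x 1"
  obtain u2 where u2: "0 < u2" "u2 < 1" "face_le (sv p1) (sv ((1 - u2) *\<^sub>R p1 + u2 *\<^sub>R x 2))"
    using ex_face_le_step by blast
  define p2 where "p2 = (1 - u2) *\<^sub>R p1 + u2 *\<^sub>R x 2"
  obtain u3 where u3: "0 < u3" "u3 < 1" "face_le (sv p2) (sv ((1 - u3) *\<^sub>R p2 + u3 *\<^sub>R x 3))"
    using ex_face_le_step by blast
  define p3 where "p3 = (1 - u3) *\<^sub>R p2 + u3 *\<^sub>R x 3"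
  have "x 0 \<in> body"
    using point_in_body n4 by simp
  then have "p1 \<in> body"
    unfolding p1_def using u1 by (intro in_body) auto
  then have "p2 \<in> body"
    unfolding p2_def using u2 by (intro in_body) auto
  then have "p3 \<in> body"
    unfolding p3_def using u3 by (intro in_body) auto
  have zero: "plane_fun x (i, j, k) (x i) = 0" "plane_fun x (i, j, k) (x j) = 0" "plane_fun x (i, j, k) (x k) = 0" for i j k
    by (simp_all add: plane_fun_eq)
  have "plane_fun x (0, 1, 2) p1 = 0" "plane_fun x (0, 1, 3) p1 = 0"
    "plane_fun x (0, 2, 3) p1 = u1 * plane_fun x (0, 2, 3) (x 1)"
    unfolding p1_def plane_fun_affine zero by simp_all
  moreover from this have "plane_fun x (0, 1, 2) p2 = 0" "plane_fun x (0, 1, 3) p2 = u2 * plane_fun x (0, 1, 3) (x 2)"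
    unfolding p2_def plane_fun_affine zero by simp_all
  moreover from this have "plane_fun x (0, 1, 2) p3 = u3 * plane_fun x (0, 1, 2) (x 3)"
    unfolding p3_def plane_fun_affine by simp
  ultimately have "flag (x 0) p1 p2 p3"
    using u1(1) u2(1) u3(1) by (simp add: flag_def zero sgn_mult)
  then show ?thesis
    using \<open>x 0 \<in> body\<close> \<open>p1 \<in> body\<close> \<open>p2 \<in> body\<close> \<open>p3 \<in> body\<close> u1(3) u2(3) u3(3)
    unfolding p1_def[symmetric] p2_def[symmetric] p3_def[symmetric] by blast
qed

end

text \<open>The case x' = x is used as well: it moves a flag to other points of the same
  cells.\<close>

lemma flag_transfer:
  assumes "generic_points n x" "generic_points n x'"
    and iso: "SGeom_isomorphic n (SGeom_Aff x) (SGeom_Aff x')"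
    and flag: "generic_points.flag x p0 p1 p2 p3"
    and sv: "sign_vector (triples n) (plane_fun x') q0 = sign_vector (triples n) (plane_fun x) p0"
      "sign_vector (triples n) (plane_fun x') q1 = sign_vector (triples n) (plane_fun x) p1"
      "sign_vector (triples n) (plane_fun x') q2 = sign_vector (triples n) (plane_fun x) p2"
      "sign_vector (triples n) (plane_fun x') q3 = sign_vector (triples n) (plane_fun x) p3"
  shows "generic_points.flag x' q0 q1 q2 q3"
proof -
  interpret X: generic_points n x by fact
  interpret Y: generic_points n x' by fact
  have T: "(0, 1, 2) \<in> triples n" "(0, 1, 3) \<in> triples n" "(0, 2, 3) \<in> triples n"
    using X.n4 by (auto simp: triples_def)
  have eq: "sgn (plane_fun x' I q) = sgn (plane_fun x I p)"
    if "sign_vector (triples n) (plane_fun x') q = sign_vector (triples n) (plane_fun x) p" "I \<in> triples n" for I p q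
    using fun_cong[OF that(1), of I] that(2) by (simp add: sign_vector_def)
  have chi: "sgn (plane_fun x' (0, 2, 3) (x' 1)) = sgn (plane_fun x (0, 2, 3) (x 1))"
    "sgn (plane_fun x' (0, 1, 3) (x' 2)) = sgn (plane_fun x (0, 1, 3) (x 2))"
    "sgn (plane_fun x' (0, 1, 2) (x' 3)) = sgn (plane_fun x (0, 1, 2) (x 3))"
    using X.n4 by (intro SGeom_isomorphic_sgn(1)[OF iso, symmetric]; simp)+
  show ?thesis
    using flag unfolding X.flag_def Y.flag_def chi eq[OF sv(1) T(1)] eq[OF sv(1) T(2)] eq[OF sv(1) T(3)]
      eq[OF sv(2) T(1)] eq[OF sv(2) T(2)] eq[OF sv(2) T(3)] eq[OF sv(3) T(1)] eq[OF sv(3) T(2)] eq[OF sv(4) T(1)] .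
qed

lemma ambient_isotopic_generic_points:
  assumes gx: "generic_points n x" and gx': "generic_points n x'"
    and iso: "SGeom_isomorphic n (SGeom_Aff x) (SGeom_Aff x')"
  shows "ambient_isotopic (polygonal_knot n x) (polygonal_knot n x')"
proof -
  interpret X: generic_points n x by fact
  interpret Y: generic_points n x' by fact
  have iso': "SGeom_isomorphic n (SGeom_Aff x') (SGeom_Aff x)"
    by (rule SGeom_isomorphic_sym[OF iso])
  have S: "X.sv ` X.body = Y.sv ` Y.body"
  proof (intro equalityI image_subsetI)
    fix p assume "p \<in> X.body"
    then show "X.sv p \<in> Y.sv ` Y.body"
      using same_sign_vectors[OF gx gx' iso] by (metis image_eqI)
  next
    fix p assume "p \<in> Y.body"
    then show "Y.sv p \<in> X.sv ` X.body"
      using same_sign_vectors[OF gx' gx iso'] by (metis image_eqI)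
  qed
  show ?thesis
  proof (rule cells_homeomorphism[OF X.cells_axioms Y.cells_axioms S])
    fix F F' c c'
    assume F: "homeomorphism X.body Y.body F F'"
      and svF: "\<And>p. p \<in> X.body \<Longrightarrow> Y.sv (F p) = X.sv p"
      and c: "\<And>p. p \<in> X.body \<Longrightarrow> c (X.sv p) \<in> X.body \<and> X.sv (c (X.sv p)) = X.sv p"
      and c': "\<And>p. p \<in> X.body \<Longrightarrow> c' (X.sv p) \<in> Y.body \<and> Y.sv (c' (X.sv p)) = X.sv p"
      and hull: "\<And>C z. C \<subseteq> X.sv ` X.body \<Longrightarrow> \<forall>\<sigma>\<in>C. \<forall>\<tau>\<in>C. face_le \<sigma> \<tau> \<or> face_le \<tau> \<sigma> \<Longrightarrow>
          z \<in> convex hull ((\<lambda>\<sigma>. (c \<sigma>, c' \<sigma>)) ` C) \<Longrightarrow> fst z \<in> X.body \<and> F (fst z) = snd z"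
    have F_inv: "F p \<in> Y.body" "F' (F p) = p" if "p \<in> X.body" for p
      using F that by (auto simp: homeomorphism_def)
    have F'_inv: "F' q \<in> X.body" "F (F' q) = q" if "q \<in> Y.body" for q
      using F that by (auto simp: homeomorphism_def)
    obtain a where a: "\<And>I. I \<in> X.facets \<Longrightarrow> 0 < plane_fun x I a"
      using X.ex_center by blast
    obtain a' where a': "\<And>I. I \<in> Y.facets \<Longrightarrow> 0 < plane_fun x' I a'"
      using Y.ex_center by blast
    define g where "g = plane_gauge X.facets (plane_fun x) a"
    define g' where "g' = plane_gauge Y.facets (plane_fun x') a'"
    have g: "g p \<le> 1 \<longleftrightarrow> (\<forall>I\<in>X.facets. 0 \<le> plane_fun x I p)"
      "g p = 1 \<longleftrightarrow> (\<forall>I\<in>X.facets. 0 \<le> plane_fun x I p) \<and> (\<exists>I\<in>X.facets. plane_fun x I p = 0)"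
      "continuous_on UNIV g" "0 < s \<Longrightarrow> g (a + s *\<^sub>R (p - a)) = s * g p" for p s
      unfolding g_def
      by (intro plane_gauge_le_1_iff plane_gauge_eq_1_iff continuous_on_plane_gauge plane_gauge_homogeneous
          X.finite_facets X.facets_nonempty X.cont X.affine a; assumption)+
    have g': "g' p \<le> 1 \<longleftrightarrow> (\<forall>I\<in>Y.facets. 0 \<le> plane_fun x' I p)"
      "g' p = 1 \<longleftrightarrow> (\<forall>I\<in>Y.facets. 0 \<le> plane_fun x' I p) \<and> (\<exists>I\<in>Y.facets. plane_fun x' I p = 0)"
      "continuous_on UNIV g'" "0 < s \<Longrightarrow> g' (a' + s *\<^sub>R (p - a')) = s * g' p" for p s
      unfolding g'_def
      by (intro plane_gauge_le_1_iff plane_gauge_eq_1_iff continuous_on_plane_gauge plane_gauge_homogeneous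
          Y.finite_facets Y.facets_nonempty Y.cont Y.affine a'; assumption)+
    have body: "{p. g p \<le> 1} = X.body" "{p. g' p \<le> 1} = Y.body"
      unfolding g(1) g'(1) X.body_def Y.body_def by simp_all
    define E where "E = radial_ext g a a' F"
    have E: "homeomorphism UNIV UNIV E (radial_ext g' a' a F')"
      unfolding E_def
    proof (rule homeomorphism_radial_ext[OF g(3,4) g'(3,4)])
      show "homeomorphism {p. g p \<le> 1} {p. g' p \<le> 1} F F'"
        unfolding body by (rule F)
      \<comment> \<open>On the boundary of the body some facet function vanishes, which is a
        condition on the sign vector.\<close>
      show "(g' (F p) = 1) = (g p = 1)" if "g p \<le> 1" for p
      proof -
        have p: "p \<in> X.body"
          using that body(1) by blast
        have "plane_fun x' I (F p) = 0 \<longleftrightarrow> plane_fun x I p = 0" if "I \<in> X.facets" for I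
        proof -
          have "I \<in> triples n"
            using that unfolding X.facets_def by blast
          then have "sgn (plane_fun x' I (F p)) = sgn (plane_fun x I p)"
            using fun_cong[OF svF[OF p], of I] by (simp add: sign_vector_def)
          then show ?thesis
            by (metis sgn_eq_0_iff)
        qed
        then show ?thesis
          using p F_inv(1)[OF p] facets_eq[OF gx gx' iso]
          unfolding g(2) g'(2) X.body_def Y.body_def by auto
      qed
    qed
    have EF: "E p = F p" if "p \<in> X.body" for p
    proof -
      have "g p \<le> 1"
        using that body(1) by blast
      then show ?thesis
        by (simp add: E_def radial_ext_def)
    qed
    have "isotopic_to_id E"
    proof -
      obtain p0 p1 p2 p3 where p: "p0 \<in> X.body" "p1 \<in> X.body" "p2 \<in> X.body" "p3 \<in> X.body"
        and flag: "X.flag p0 p1 p2 p3"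
        and le: "face_le (X.sv p0) (X.sv p1)" "face_le (X.sv p1) (X.sv p2)" "face_le (X.sv p2) (X.sv p3)"
        using X.ex_flag by auto
      \<comment> \<open>The points p only single out a chain of cells. The map is known to be affine
        on the hull of the cone points of these cells, so the flag is carried over to those on both
        sides.\<close>
      define q0 q1 q2 q3 where q: "q0 = c (X.sv p0)" "q1 = c (X.sv p1)" "q2 = c (X.sv p2)" "q3 = c (X.sv p3)"
      define r0 r1 r2 r3 where r: "r0 = c' (X.sv p0)" "r1 = c' (X.sv p1)" "r2 = c' (X.sv p2)" "r3 = c' (X.sv p3)"
      have "X.flag q0 q1 q2 q3"
      proof -
        have "SGeom_isomorphic n (SGeom_Aff x) (SGeom_Aff x)"
          by (simp add: SGeom_isomorphic_def Let_def)
        from flag_transfer[OF gx gx this flag] show ?thesis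
          using c p by (simp add: q)
      qed
      moreover have "Y.flag r0 r1 r2 r3"
        using flag_transfer[OF gx gx' iso flag] c' p by (simp add: r)
      moreover have chi: "sgn (plane_fun x (0, 1, 2) (x 3)) = sgn (plane_fun x' (0, 1, 2) (x' 3))"
        using X.n4 by (intro SGeom_isomorphic_sgn(1)[OF iso]) auto
      ultimately have sgn_eq: "sgn (det4 (homogenize q0) (homogenize q1) (homogenize q2) (homogenize q3)) =
          sgn (det4 (homogenize r0) (homogenize r1) (homogenize r2) (homogenize r3))"
        and nz: "det4 (homogenize q0) (homogenize q1) (homogenize q2) (homogenize q3) \<noteq> 0"
        using X.sgn_det4_if_flag[of q0 q1 q2 q3] Y.sgn_det4_if_flag[of r0 r1 r2 r3] X.base_nz
        by (auto simp: plane_fun_eq sgn_eq_0_iff)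
      have "0 < det (vector [q1 - q0, q2 - q0, q3 - q0] :: real^3^3) * det (vector [r1 - r0, r2 - r0, r3 - r0] :: real^3^3)"
        using sgn_eq nz unfolding det4_homogenize by (auto simp: sgn_if zero_less_mult_iff split: if_splits)
      then obtain A :: "real^3^3" where A: "0 < det A" "A *v (q1 - q0) = r1 - r0" "A *v (q2 - q0) = r2 - r0" "A *v (q3 - q0) = r3 - r0"
        using ex_affine_map by blast
      define C where "C = {X.sv p0, X.sv p1, X.sv p2, X.sv p3}"
      have z: "(\<lambda>\<sigma>. (c \<sigma>, c' \<sigma>)) ` C = {(q0, r0), (q1, r1), (q2, r2), (q3, r3)}"
        by (simp add: C_def q r)
      let ?U = "interior (convex hull {q0, q1, q2, q3})"
      have EU: "E p = r0 + A *v (p - q0)" if "p \<in> ?U" for p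
      proof -
        have "convex hull {q0, q1, q2, q3} = fst ` (convex hull ((\<lambda>\<sigma>. (c \<sigma>, c' \<sigma>)) ` C))"
          unfolding z convex_hull_linear_image[OF linear_fst] by simp
        then obtain w where w: "w \<in> convex hull ((\<lambda>\<sigma>. (c \<sigma>, c' \<sigma>)) ` C)" "p = fst w"
          using \<open>p \<in> ?U\<close> interior_subset by blast
        have "C \<subseteq> X.sv ` X.body"
          using p by (auto simp: C_def)
        moreover have "\<forall>\<sigma>\<in>C. \<forall>\<tau>\<in>C. face_le \<sigma> \<tau> \<or> face_le \<tau> \<sigma>"
          using le le(1)[THEN face_le_trans, OF le(2)] le(2)[THEN face_le_trans, OF le(3)]
            le(1)[THEN face_le_trans, OF le(2)[THEN face_le_trans, OF le(3)]] by (auto simp: C_def)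
        ultimately have "fst w \<in> X.body" "F (fst w) = snd w"
          using hull w(1) by blast+
        \<comment> \<open>The graph of an affine map is convex, so with the four vertices it
          contains their hull.\<close>
        moreover have "convex hull ((\<lambda>\<sigma>. (c \<sigma>, c' \<sigma>)) ` C) \<subseteq> {w. snd w = r0 + A *v (fst w - q0)}"
        proof (rule hull_minimal)
          show "(\<lambda>\<sigma>. (c \<sigma>, c' \<sigma>)) ` C \<subseteq> {w. snd w = r0 + A *v (fst w - q0)}"
            unfolding z using A by simp
          have lin: "A *v ((1 - u) *\<^sub>R v + u *\<^sub>R w - q0) = (1 - u) *\<^sub>R (A *v (v - q0)) + u *\<^sub>R (A *v (w - q0))" for u v w
            by (simp add: algebra_simps)
          show "convex {w. snd w = r0 + A *v (fst w - q0)}"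
            unfolding convex_alt
          proof (intro ballI allI impI)
            fix v w and u :: real
            assume "v \<in> {w. snd w = r0 + A *v (fst w - q0)}" "w \<in> {w. snd w = r0 + A *v (fst w - q0)}"
            then have v: "snd v = r0 + A *v (fst v - q0)" and w: "snd w = r0 + A *v (fst w - q0)"
              by simp_all
            show "(1 - u) *\<^sub>R v + u *\<^sub>R w \<in> {w. snd w = r0 + A *v (fst w - q0)}"
              unfolding mem_Collect_eq fst_add snd_add fst_scaleR snd_scaleR lin v w
              by (simp add: scaleR_add_right scaleR_left_diff_distrib)
          qed
        qed
        ultimately show ?thesis
          using w EF by auto
      qed
      \<comment> \<open>A convex set without interior lies in a plane, which would make the
        determinant of the four vertices 0.\<close>
      have "?U \<noteq> {}"
      proof
        assume "?U = {}"
        then obtain b d where b: "b \<noteq> 0" "convex hull {q0, q1, q2, q3} \<subseteq> {v. b \<bullet> v = d}"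
          using empty_interior_subset_hyperplane[OF convex_convex_hull] by metis
        then have "{q0, q1, q2, q3} \<subseteq> {v. b \<bullet> v = d}"
          using hull_subset[of "{q0, q1, q2, q3}" convex] by (rule_tac subset_trans)
        then show False
          using det4_homogenize_eq_0_if_hyperplane[OF b(1)] nz by blast
      qed
      then obtain b where b: "b \<in> ?U" by blast
      have "E p = E b + A *v (p - b)" if "p \<in> ?U" for p
        by (simp add: EU[OF that] EU[OF b] matrix_vector_mult_diff_distrib)
      then show ?thesis
        using isotopic_to_id_if_locally_affine[OF E open_interior b _ A(1)] by blast
    qed
    moreover have "E ` polygonal_knot n x = polygonal_knot n x'"
    proof -
      have "E ` closed_segment (x i) (x ((i + 1) mod n)) = closed_segment (x' i) (x' ((i + 1) mod n))" if "i < n" for i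
      proof -
        let ?j = "(i + 1) mod n"
        have ij: "i < n" "?j < n" "i \<noteq> ?j"
          using that X.n4 by (auto simp: mod_if split: if_splits)
        have segX: "closed_segment (x i) (x ?j) \<subseteq> X.body"
          using ij by (intro closed_segment_subset X.convex_body X.point_in_body)
        have segY: "closed_segment (x' i) (x' ?j) \<subseteq> Y.body"
          using ij by (intro closed_segment_subset Y.convex_body Y.point_in_body)
        show ?thesis
        \<comment> \<open>The sign vector decides membership in the segment, and F' preserves sign
          vectors as F does.\<close>
        proof (intro equalityI image_subsetI subsetI)
          fix p assume p: "p \<in> closed_segment (x i) (x ?j)"
          then have "p \<in> X.body"
            using segX by blast
          then show "E p \<in> closed_segment (x' i) (x' ?j)"
            using segment_sign_vector[OF gx gx' iso ij p] svF EF by simp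
        next
          fix q assume q: "q \<in> closed_segment (x' i) (x' ?j)"
          then have qY: "q \<in> Y.body"
            using segY by blast
          have "F' q \<in> closed_segment (x i) (x ?j)"
            using segment_sign_vector[OF gx' gx iso' ij q, of "F' q"] svF[OF F'_inv(1)[OF qY]] F'_inv(2)[OF qY] by simp
          moreover have "E (F' q) = q"
            using EF[OF F'_inv(1)[OF qY]] F'_inv(2)[OF qY] by simp
          ultimately show "q \<in> E ` closed_segment (x i) (x ?j)"
            by (metis image_eqI)
        qed
      qed
      then show ?thesis
        unfolding polygonal_knot_def image_UN by auto
    qed
    ultimately show ?thesis
      by (rule ambient_isotopic_image)
  qed
qed

text \<open>The vertices together with x 0 plus the normal of the triangle form a positively
  oriented simplex, the determinant being the squared norm of the normal. So some affine map of
  positive determinant takes one labelled triangle to the other.\<close>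

lemma ambient_isotopic_triangles:
  assumes "\<not> collinear {x 0, x 1, x 2}" "\<not> collinear {x' 0, x' 1, x' 2}"
  shows "ambient_isotopic (polygonal_knot 3 x) (polygonal_knot 3 x')"
proof -
  define m where "m = (\<lambda>x :: nat \<Rightarrow> real^3. cross3 (x 1 - x 0) (x 2 - x 0))"
  have pos: "0 < det (vector [x 1 - x 0, x 2 - x 0, (x 0 + m x) - x 0] :: real^3^3)"
    if "\<not> collinear {x 0, x 1, x 2}" for x :: "nat \<Rightarrow> real^3"
  proof -
    have "{x 1, x 0, x 2} = {x 0, x 1, x 2}" by auto
    then have "m x \<noteq> 0"
      using that collinear_3[of "x 1" "x 0" "x 2"] by (simp add: m_def cross_eq_0)
    moreover have "det (vector [x 1 - x 0, x 2 - x 0, (x 0 + m x) - x 0] :: real^3^3) = m x \<bullet> m x"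
      by (simp add: m_def cross3_simps)
    ultimately show ?thesis by simp
  qed
  obtain A :: "real^3^3" where A: "0 < det A" "A *v (x 1 - x 0) = x' 1 - x' 0" "A *v (x 2 - x 0) = x' 2 - x' 0"
    using ex_affine_map[OF mult_pos_pos[OF pos[OF assms(1)] pos[OF assms(2)]]] by blast
  define E where "E = (\<lambda>p. p + x' 0) \<circ> (*v) A \<circ> (\<lambda>p. p + (- x 0))"
  have "isotopic_to_id E"
    unfolding E_def by (intro isotopic_to_id_compose isotopic_to_id_translation isotopic_to_id_matrix A(1))
  moreover have "E ` polygonal_knot 3 x = polygonal_knot 3 x'"
  proof -
    have vertex: "E (x 0) = x' 0" "E (x 1) = x' 1" "E (x 2) = x' 2"
      using A by (simp_all add: E_def)
    have "E ((1 - u) *\<^sub>R p + u *\<^sub>R q) = (1 - u) *\<^sub>R E p + u *\<^sub>R E q" for u p q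
      by (simp add: E_def matrix_vector_right_distrib matrix_vector_mult_diff_distrib matrix_vector_mult_scaleR algebra_simps)
    then have seg: "E ` closed_segment p q = closed_segment (E p) (E q)" for p q
      unfolding closed_segment_image_interval by (simp add: image_image)
    have "{..<3} = {0, 1, 2::nat}" by auto
    then show ?thesis
      unfolding polygonal_knot_def image_UN seg by (simp add: vertex vertex(2)[unfolded One_nat_def] numeral_2_eq_2[symmetric])
  qed
  ultimately show ?thesis
    by (rule ambient_isotopic_image)
qed

theorem theorem1p1:
  fixes n :: nat and x x' :: "nat \<Rightarrow> real^3"
  assumes "n \<ge> 3"
    and "general_position n x"
    and "general_position n x'"
    and "SGeom_isomorphic n (SGeom_Aff x) (SGeom_Aff x')"
  shows "ambient_isotopic (polygonal_knot n x) (polygonal_knot n x')"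
proof (cases "n = 3")
  case True
  then show ?thesis
    using assms(2,3) ambient_isotopic_triangles by (simp add: general_position_def)
next
  case False
  then have "4 \<le> n"
    using assms(1) by simp
  then show ?thesis
    using assms generic_points_if_general_position ambient_isotopic_generic_points by blast
qed

end
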